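(* For every skew shifted shape $\nu/\mu$ (that is, strict partitions $\mu\subseteq\nu$) there is a signed permutation $w$ with $G^C_w=GQ^{(\beta)}_{\nu/\mu}$.
   Context: **Signed permutations.** $W_n$ is the group of bijections $w$ of $\{-n,\dots,-1,1,\dots,n\}$ with $w(-i)=-w(i)$; Coxeter generators $s_0=(-1\ 1)$, $s_i=(-i{-}1\ \,{-}i)(i\ \,i{+}1)$ for $1\le i\le n-1$. **$G^C_w$.** Let $u_0,\dots,u_{n-1}$ be noncommuting variables (commuting with $\beta$ and $x_1,x_2,\dots$) with $u_i^2=\beta u_i$, $u_1u_0u_1u_0=u_0u_1u_0u_1$, $u_iu_{i+1}u_i=u_{i+1}u_iu_{i+1}$ ($i>0$), $u_iu_j=u_ju_i$ ($|i-j|>1$). For $w\in W_n$ with reduced word $(a_1,\dots,a_\ell)$ put $u_w=u_{a_1}\cdots u_{a_\ell}$. $G^C_w$ is the coefficient of $u_w$ in $$\prod_{i\ge1}(1+x_iu_{n-1})\cdots(1+x_iu_1)(1+x_iu_0)(1+x_iu_0)(1+x_iu_1)\cdots(1+x_iu_{n-1}),$$ the product taken in order $i=1,2,\dots$ from left to right. **$GQ$.** A strict partition is $\lambda=(\lambda_1>\dots>\lambda_k>0)$, with shifted diagram $D_\lambda=\{(i,j):1\le i\le k,\ i\le j\le\lambda_i+i-1\}$; $\mu\subseteq\nu$ means $D_\mu\subseteq D_\nu$, and $D_{\nu/\mu}=D_\nu\setminus D_\mu$, $|\nu/\mu|=|D_{\nu/\mu}|$. Order $\mathbb{Z}\setminus\{0\}$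 by $\bar1\prec1\prec\bar2\prec2\prec\cdots$, where $\bar a=-a$. A shifted set-valued semistandard tableau of shape $\nu/\mu$ is a filling $T$ of $D_{\nu/\mu}$ by finite nonempty subsets of $\mathbb{Z}\setminus\{0\}$ with $\max T_{ij}\preceq\min T_{i+1,j}$, equality allowed only for negative values, and $\max T_{ij}\preceq\min T_{i,j+1}$, equality allowed only for positive values (whenever the cells exist; $\max,\min$ with respect to $\prec$). With $|T|=\sum|T_{ij}|$ and $x^T=\prod_{(i,j)}\prod_{s\in T_{ij}}x_{|s|}$, set $GQ^{(\beta)}_{\nu/\mu}=\sum_T\beta^{|T|-|\nu/\mu|}x^T$. *)

theory Defs
  imports
    "HOL-Library.Poly_Mapping"
    "HOL-Computational_Algebra.Polynomial"
    "HOL-Combinatorics.Permutations"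
begin

subsection \<open>Signed permutations\<close>

text \<open>Elements of \<open>W\<^sub>n\<close> are functions on all integers that fix every integer outside
  \<open>{-n,\<dots>,-1,1,\<dots>,n}\<close>.\<close>

definition signed_perms :: "nat \<Rightarrow> (int \<Rightarrow> int) set" where
  "signed_perms n = {w. w permutes ({- int n..int n} - {0}) \<and> (\<forall>i. w (- i) = - w i)}"

definition cox_gen :: "nat \<Rightarrow> int \<Rightarrow> int" where
  "cox_gen i =
    (if i = 0 then transpose (- 1) 1
     else transpose (- int i - 1) (- int i) \<circ> transpose (int i) (int i + 1))"

definition word_perm :: "nat list \<Rightarrow> int \<Rightarrow> int" where
  "word_perm a = foldr (\<circ>) (map cox_gen a) id"

definition reduced_word :: "nat \<Rightarrow> (int \<Rightarrow> int) \<Rightarrow> nat list \<Rightarrow> bool" where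
  "reduced_word n w a \<longleftrightarrow>
    set a \<subseteq> {..<n} \<and> word_perm a = w \<and>
    (\<forall>b. set b \<subseteq> {..<n} \<and> word_perm b = w \<longrightarrow> length a \<le> length b)"

subsection \<open>The algebra generated by the variables \<open>u\<^sub>i\<close>\<close>

text \<open>The free monoid, written additively so that finitely supported functions on it form the
  free associative algebra with the convolution product of \<^typ>\<open>'a \<Rightarrow>\<^sub>0 'b\<close>.\<close>

datatype uword = UWord (letters: "nat list")

instantiation uword :: monoid_add
begin

definition zero_uword :: uword where
  "0 = UWord []"

definition plus_uword :: "uword \<Rightarrow> uword \<Rightarrow> uword" where
  "a + b = UWord (letters a @ letters b)"

instance
  by standard (simp_all add: zero_uword_def plus_uword_def)

end

type_synonym monom = "nat \<Rightarrow>\<^sub>0 nat"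

text \<open>Coefficients live in \<open>\<int>[\<beta>]\<close>, modelled as \<^typ>\<open>int poly\<close>.\<close>

type_synonym xpoly = "monom \<Rightarrow>\<^sub>0 int poly"
type_synonym xseries = "monom \<Rightarrow> int poly"
type_synonym ualg = "uword \<Rightarrow>\<^sub>0 xpoly"

definition beta :: "int poly" where
  "beta = [:0, 1:]"

definition xvar :: "nat \<Rightarrow> xpoly" where
  "xvar i = Poly_Mapping.single (Poly_Mapping.single i 1) 1"

definition scal :: "xpoly \<Rightarrow> ualg" where
  "scal c = Poly_Mapping.single 0 c"

definition ugen :: "nat \<Rightarrow> ualg" where
  "ugen i = Poly_Mapping.single (UWord [i]) 1"

definition free_ualg :: "nat \<Rightarrow> ualg set" where
  "free_ualg n = {f. \<forall>a \<in> Poly_Mapping.keys f. set (letters a) \<subseteq> {..<n}}"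

definition relators :: "nat \<Rightarrow> ualg set" where
  "relators n =
    {ugen i * ugen i - scal (Poly_Mapping.single 0 beta) * ugen i | i. i < n}
  \<union> (if 1 < n then {ugen 1 * ugen 0 * ugen 1 * ugen 0 - ugen 0 * ugen 1 * ugen 0 * ugen 1} else {})
  \<union> {ugen i * ugen (i + 1) * ugen i - ugen (i + 1) * ugen i * ugen (i + 1) | i. 0 < i \<and> i + 1 < n}
  \<union> {ugen i * ugen j - ugen j * ugen i | i j. i < n \<and> j < n \<and> \<bar>int i - int j\<bar> > 1}"

text \<open>The two-sided ideal of \<^term>\<open>free_ualg n\<close> generated by the relators; the algebra in
  question is the quotient by it.\<close>

inductive_set rel_ideal :: "nat \<Rightarrow> ualg set" for n where
  zero: "0 \<in> rel_ideal n"
| add: "f \<in> rel_ideal n \<Longrightarrow> g \<in> rel_ideal n \<Longrightarrow> f + g \<in> rel_ideal n"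
| gen: "r \<in> relators n \<Longrightarrow> p \<in> free_ualg n \<Longrightarrow> q \<in> free_ualg n \<Longrightarrow> p * r * q \<in> rel_ideal n"

text \<open>A representative in the free algebra of \<open>u\<^sub>w\<close>; modulo \<^term>\<open>rel_ideal n\<close> it does not depend
  on the reduced word chosen.\<close>

definition u_perm :: "nat \<Rightarrow> (int \<Rightarrow> int) \<Rightarrow> ualg" where
  "u_perm n w = prod_list (map ugen (SOME a. reduced_word n w a))"

subsection \<open>The power series \<open>G\<^sup>C\<^sub>w\<close>\<close>

definition C_factor :: "nat \<Rightarrow> nat \<Rightarrow> ualg" where
  "C_factor n i = prod_list (map (\<lambda>k. 1 + scal (xvar i) * ugen k) (rev [0..<n] @ [0..<n]))"

definition C_prod :: "nat \<Rightarrow> nat \<Rightarrow> ualg" where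
  "C_prod n m = prod_list (map (C_factor n) [1..<Suc m])"

text \<open>The coordinates of an element modulo \<^term>\<open>rel_ideal n\<close> in the basis \<open>u\<^sub>w\<close>.\<close>

definition u_coeffs :: "nat \<Rightarrow> ualg \<Rightarrow> (int \<Rightarrow> int) \<Rightarrow> xpoly" where
  "u_coeffs n f =
    (THE c. (\<forall>w. w \<notin> signed_perms n \<longrightarrow> c w = 0) \<and>
            f - (\<Sum>w\<in>signed_perms n. scal (c w) * u_perm n w) \<in> rel_ideal n)"

text \<open>The infinite product is the coefficientwise limit of the finite products over
  \<open>x\<^sub>1,\<dots>,x\<^sub>m\<close>: the coefficient of a fixed monomial is eventually constant in \<open>m\<close>.\<close>

definition GC :: "nat \<Rightarrow> (int \<Rightarrow> int) \<Rightarrow> xseries" where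
  "GC n w = (\<lambda>\<alpha>. THE c. \<forall>\<^sub>F m in sequentially.
      Poly_Mapping.lookup (u_coeffs n (C_prod n m) w) \<alpha> = c)"

subsection \<open>Shifted set-valued tableaux and \<open>GQ\<close>\<close>

definition strict_partition :: "nat list \<Rightarrow> bool" where
  "strict_partition l \<longleftrightarrow> sorted_wrt (>) l \<and> 0 \<notin> set l"

definition shifted_diagram :: "nat list \<Rightarrow> (nat \<times> nat) set" where
  "shifted_diagram l =
    {(i, j). 1 \<le> i \<and> i \<le> length l \<and> i \<le> j \<and> j \<le> l ! (i - 1) + i - 1}"

definition skew_diagram :: "nat list \<Rightarrow> nat list \<Rightarrow> (nat \<times> nat) set" where
  "skew_diagram \<nu> \<mu> = shifted_diagram \<nu> - shifted_diagram \<mu>"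

text \<open>The order \<open>-1 \<prec> 1 \<prec> -2 \<prec> 2 \<prec> \<dots>\<close> on the nonzero integers.\<close>

definition prec :: "int \<Rightarrow> int \<Rightarrow> bool" where
  "prec a b \<longleftrightarrow> \<bar>a\<bar> < \<bar>b\<bar> \<or> (\<bar>a\<bar> = \<bar>b\<bar> \<and> a < b)"

definition prec_max :: "int set \<Rightarrow> int" where
  "prec_max S = (THE s. s \<in> S \<and> (\<forall>t\<in>S. t = s \<or> prec t s))"

definition prec_min :: "int set \<Rightarrow> int" where
  "prec_min S = (THE s. s \<in> S \<and> (\<forall>t\<in>S. t = s \<or> prec s t))"

text \<open>Fillings are total functions that are empty off the diagram, so that distinct functions
  are distinct fillings.\<close>

definition set_valued_tableaux :: "nat list \<Rightarrow> nat list \<Rightarrow> (nat \<times> nat \<Rightarrow> int set) set" where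
  "set_valued_tableaux \<nu> \<mu> = {T.
     (\<forall>c. c \<notin> skew_diagram \<nu> \<mu> \<longrightarrow> T c = {}) \<and>
     (\<forall>c \<in> skew_diagram \<nu> \<mu>. finite (T c) \<and> T c \<noteq> {} \<and> 0 \<notin> T c) \<and>
     (\<forall>i j. (i, j) \<in> skew_diagram \<nu> \<mu> \<and> (i + 1, j) \<in> skew_diagram \<nu> \<mu> \<longrightarrow>
        (let a = prec_max (T (i, j)); b = prec_min (T (i + 1, j))
         in prec a b \<or> (a = b \<and> a < 0))) \<and>
     (\<forall>i j. (i, j) \<in> skew_diagram \<nu> \<mu> \<and> (i, j + 1) \<in> skew_diagram \<nu> \<mu> \<longrightarrow>
        (let a = prec_max (T (i, j)); b = prec_min (T (i, j + 1))
         in prec a b \<or> (a = b \<and> a > 0)))}"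

definition tableau_size :: "nat list \<Rightarrow> nat list \<Rightarrow> (nat \<times> nat \<Rightarrow> int set) \<Rightarrow> nat" where
  "tableau_size \<nu> \<mu> T = (\<Sum>c\<in>skew_diagram \<nu> \<mu>. card (T c))"

definition tableau_weight :: "nat list \<Rightarrow> nat list \<Rightarrow> (nat \<times> nat \<Rightarrow> int set) \<Rightarrow> monom" where
  "tableau_weight \<nu> \<mu> T =
    (\<Sum>c\<in>skew_diagram \<nu> \<mu>. \<Sum>s\<in>T c. Poly_Mapping.single (nat \<bar>s\<bar>) 1)"

definition GQ :: "nat list \<Rightarrow> nat list \<Rightarrow> xseries" where
  "GQ \<nu> \<mu> = (\<lambda>\<alpha>. \<Sum>T | T \<in> set_valued_tableaux \<nu> \<mu> \<and> tableau_weight \<nu> \<mu> T = \<alpha>.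
      beta ^ (tableau_size \<nu> \<mu> T - card (skew_diagram \<nu> \<mu>)))"

end

theory Submission
  imports Defs
begin

text \<open>
  Number the boxes of a shifted diagram by their diagonals. Letting \<open>u\<^sub>i\<close> add a box on the
  \<open>i\<close>-th diagonal, multiply by \<open>\<beta>\<close> if the last box there is a removable box of the skew shape,
  and be zero otherwise, turns the shapes between \<open>\<mu>\<close> and \<open>\<nu>\<close> into a module over the algebra of
  the \<open>u\<^sub>i\<close>, on which both sides of each braid relation of length three or four act as zero. Any
  two orders in which the boxes of \<open>\<nu>/\<mu>\<close> can be added give reduced words of the same signed
  permutation \<open>w\<close>, and no other \<open>u\<^sub>v\<close> takes \<open>\<mu>\<close> to a multiple of \<open>\<nu>\<close>. So \<open>G\<^sup>C\<^sub>w\<close> is the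
  coefficient of \<open>\<nu>\<close> in the image of \<open>\<mu>\<close> under the product of the factors \<open>1 + x\<^sub>k u\<^sub>i\<close>, and
  recording which factor acts on which box yields precisely the set-valued tableaux.

  The coordinates in the basis \<open>u\<^sub>w\<close> exist by Matsumoto's theorem, and they are unique because the
  \<open>u\<^sub>i\<close> also act on the signed permutations by the Demazure product.
\<close>

section \<open>Words and the Hecke relations\<close>

definition lin_ext :: "('a \<Rightarrow> 'b) \<Rightarrow> ('a \<Rightarrow>\<^sub>0 'b::comm_ring_1) \<Rightarrow> 'b" where
  "lin_ext E f = (\<Sum>a\<in>Poly_Mapping.keys f. Poly_Mapping.lookup f a * E a)"

lemma lin_ext_superset:
  assumes "finite S" "Poly_Mapping.keys f \<subseteq> S"
  shows "lin_ext E f = (\<Sum>a\<in>S. Poly_Mapping.lookup f a * E a)"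
  unfolding lin_ext_def using assms by (intro sum.mono_neutral_left) (auto simp: in_keys_iff)

lemma lin_ext_zero [simp]: "lin_ext E 0 = 0"
  by (simp add: lin_ext_def)

lemma lin_ext_single [simp]: "lin_ext E (Poly_Mapping.single a c) = c * E a"
  by (cases "c = 0") (simp_all add: lin_ext_def)

lemma lin_ext_add: "lin_ext E (f + g) = lin_ext E f + lin_ext E g"
proof -
  let ?S = "Poly_Mapping.keys f \<union> Poly_Mapping.keys g"
  have "lin_ext E (f + g) = (\<Sum>a\<in>?S. Poly_Mapping.lookup (f + g) a * E a)"
    by (rule lin_ext_superset) (auto dest: subsetD[OF keys_add])
  also have "\<dots> = lin_ext E f + lin_ext E g"
    by (simp add: lin_ext_superset[of ?S f] lin_ext_superset[of ?S g] lookup_add distrib_right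
        sum.distrib)
  finally show ?thesis .
qed

lemma lin_ext_diff: "lin_ext E (f - g) = lin_ext E f - lin_ext E g"
  using lin_ext_add[of E "f - g" g] by simp

lemma lin_ext_sum: "lin_ext E (\<Sum>x\<in>A. f x) = (\<Sum>x\<in>A. lin_ext E (f x))"
  by (induction A rule: infinite_finite_induct) (simp_all add: lin_ext_add)

lemma poly_mapping_eq_sum_single:
  fixes f :: "'a \<Rightarrow>\<^sub>0 'b::comm_monoid_add"
  shows "f = (\<Sum>a\<in>Poly_Mapping.keys f. Poly_Mapping.single a (Poly_Mapping.lookup f a))"
  by (rule poly_mapping_eqI) (simp add: lookup_sum lookup_single when_def in_keys_iff)

lemma lin_ext_mult_single:
  fixes f :: "'a::monoid_add \<Rightarrow>\<^sub>0 'b::comm_ring_1"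
  shows "lin_ext E (f * Poly_Mapping.single b c) = c * lin_ext (\<lambda>a. E (a + b)) f"
proof -
  let ?g = "\<lambda>a. Poly_Mapping.single a (Poly_Mapping.lookup f a)"
  have "lin_ext E (f * Poly_Mapping.single b c)
      = lin_ext E ((\<Sum>a\<in>Poly_Mapping.keys f. ?g a) * Poly_Mapping.single b c)"
    using poly_mapping_eq_sum_single[of f] by simp
  also have "\<dots> = (\<Sum>a\<in>Poly_Mapping.keys f. Poly_Mapping.lookup f a * c * E (a + b))"
    by (simp add: sum_distrib_right lin_ext_sum mult_single)
  also have "\<dots> = c * lin_ext (\<lambda>a. E (a + b)) f"
    by (simp add: lin_ext_def sum_distrib_left ac_simps)
  finally show ?thesis .
qed

lemma lin_ext_zero_fun [simp]: "lin_ext (\<lambda>_. 0) f = 0"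
  by (simp add: lin_ext_def)

lemma lin_ext_linear_fun: "lin_ext (\<lambda>a. x * E a + E' a) f = x * lin_ext E f + lin_ext E' f"
  by (simp add: lin_ext_def distrib_left sum.distrib sum_distrib_left mult.left_commute)

abbreviation xbeta :: xpoly where
  "xbeta \<equiv> Poly_Mapping.single 0 beta"

lemma xbeta_power: "xbeta ^ k = Poly_Mapping.single 0 (beta ^ k)"
  by (induction k) (simp_all add: mult_single)

lemma xbeta_power_eq_1_iff: "xbeta ^ k = 1 \<longleftrightarrow> k = 0"
proof
  assume "xbeta ^ k = 1"
  then have "Poly_Mapping.lookup (xbeta ^ k) 0 = Poly_Mapping.lookup (1 :: xpoly) 0"
    by simp
  then have "degree (beta ^ k) = 0"
    by (simp add: xbeta_power)
  then show "k = 0"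
    by (simp add: degree_power_eq beta_def)
qed simp

abbreviation u_word :: "nat list \<Rightarrow> ualg" where
  "u_word a \<equiv> Poly_Mapping.single (UWord a) 1"

lemma prod_list_ugen: "prod_list (map ugen a) = u_word a"
  by (induction a) (simp_all add: ugen_def mult_single plus_uword_def flip: zero_uword_def)

lemma u_word_append: "u_word (a @ b) = u_word a * u_word b"
  by (simp add: mult_single plus_uword_def)

lemma scal_mult_single: "scal c * Poly_Mapping.single a d = Poly_Mapping.single a (c * d)"
  by (simp add: scal_def mult_single)

lemma free_ualg_add: "p \<in> free_ualg n \<Longrightarrow> q \<in> free_ualg n \<Longrightarrow> p + q \<in> free_ualg n"
  by (auto simp: free_ualg_def dest!: subsetD[OF keys_add])

lemma free_ualg_mult: "p \<in> free_ualg n \<Longrightarrow> q \<in> free_ualg n \<Longrightarrow> p * q \<in> free_ualg n"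
  by (fastforce simp: free_ualg_def plus_uword_def dest!: subsetD[OF keys_mult])

lemma free_ualg_single: "set a \<subseteq> {..<n} \<Longrightarrow> Poly_Mapping.single (UWord a) c \<in> free_ualg n"
  by (auto simp: free_ualg_def)

lemma free_ualg_scal: "scal c \<in> free_ualg n"
  using free_ualg_single[of "[]" n c] by (simp add: scal_def zero_uword_def)

lemma free_ualg_one: "1 \<in> free_ualg n"
  using free_ualg_scal[of 1 n] by (simp add: scal_def)

lemma free_ualg_prod_list: "set fs \<subseteq> free_ualg n \<Longrightarrow> prod_list fs \<in> free_ualg n"
  by (induction fs) (simp_all add: free_ualg_one free_ualg_mult)

lemma free_ualgD: "f \<in> free_ualg n \<Longrightarrow> a \<in> Poly_Mapping.keys f \<Longrightarrow> set (letters a) \<subseteq> {..<n}"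
  by (simp add: free_ualg_def)

inductive hecke_relation :: "nat \<Rightarrow> nat list \<Rightarrow> nat list \<Rightarrow> nat \<Rightarrow> bool" for n where
  quadratic: "i < n \<Longrightarrow> hecke_relation n [i, i] [i] 1"
| braid4: "1 < n \<Longrightarrow> hecke_relation n [1, 0, 1, 0] [0, 1, 0, 1] 0"
| braid3: "0 < i \<Longrightarrow> i + 1 < n \<Longrightarrow> hecke_relation n [i, i + 1, i] [i + 1, i, i + 1] 0"
| commute: "i < n \<Longrightarrow> j < n \<Longrightarrow> \<bar>int i - int j\<bar> > 1 \<Longrightarrow> hecke_relation n [i, j] [j, i] 0"

lemma hecke_relation_letters:
  "hecke_relation n r s d \<Longrightarrow> set r \<subseteq> {..<n} \<and> set s \<subseteq> {..<n}"
  by (erule hecke_relation.cases) auto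

definition relator :: "nat list \<Rightarrow> nat list \<Rightarrow> nat \<Rightarrow> ualg" where
  "relator r s d = u_word r - scal (xbeta ^ d) * u_word s"

lemma relators_eq: "relators n = {relator r s d | r s d. hecke_relation n r s d}"
proof -
  have "relators n = {relator [i, i] [i] 1 | i. i < n}
      \<union> (if 1 < n then {relator [1, 0, 1, 0] [0, 1, 0, 1] 0} else {})
      \<union> {relator [i, i + 1, i] [i + 1, i, i + 1] 0 | i. 0 < i \<and> i + 1 < n}
      \<union> {relator [i, j] [j, i] 0 | i j. i < n \<and> j < n \<and> \<bar>int i - int j\<bar> > 1}"
    by (simp add: relators_def relator_def ugen_def scal_mult_single mult_single plus_uword_def)
  also have "\<dots> = {relator r s d | r s d. hecke_relation n r s d}"
    unfolding hecke_relation.simps by (cases "1 < n"; simp; blast)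
  finally show ?thesis .
qed

lemma rel_ideal_sum: "(\<And>x. x \<in> A \<Longrightarrow> f x \<in> rel_ideal n) \<Longrightarrow> (\<Sum>x\<in>A. f x) \<in> rel_ideal n"
  by (induction A rule: infinite_finite_induct) (simp_all add: rel_ideal.intros)

lemma rel_ideal_mult:
  assumes "p \<in> free_ualg n" "q \<in> free_ualg n"
  shows "f \<in> rel_ideal n \<Longrightarrow> p * f * q \<in> rel_ideal n"
proof (induction rule: rel_ideal.induct)
  case (gen r p' q')
  then have "(p * p') * r * (q' * q) \<in> rel_ideal n"
    using assms by (intro rel_ideal.gen free_ualg_mult)
  then show ?case by (simp add: mult.assoc)
qed (simp_all add: distrib_left distrib_right rel_ideal.intros)

definition u_equiv :: "nat \<Rightarrow> ualg \<Rightarrow> ualg \<Rightarrow> bool" where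
  "u_equiv n f g \<longleftrightarrow> f - g \<in> rel_ideal n"

lemma u_equiv_refl [simp]: "u_equiv n f f"
  by (simp add: u_equiv_def rel_ideal.zero)

lemma u_equiv_trans [trans]: "u_equiv n f g \<Longrightarrow> u_equiv n g h \<Longrightarrow> u_equiv n f h"
  unfolding u_equiv_def using rel_ideal.add[of "f - g" n "g - h"] by simp

lemma u_equiv_mult:
  "u_equiv n f g \<Longrightarrow> p \<in> free_ualg n \<Longrightarrow> q \<in> free_ualg n \<Longrightarrow> u_equiv n (p * f * q) (p * g * q)"
  unfolding u_equiv_def using rel_ideal_mult[of p n q "f - g"] by (simp add: algebra_simps)

lemma u_equiv_scal: "u_equiv n f g \<Longrightarrow> u_equiv n (scal c * f) (scal c * g)"
  using u_equiv_mult[of n f g "scal c" 1] by (simp add: free_ualg_scal free_ualg_one)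

lemma u_equiv_sym: "u_equiv n f g \<Longrightarrow> u_equiv n g f"
  using u_equiv_scal[of n f g "- 1"] unfolding u_equiv_def by (simp add: scal_def single_uminus)

lemma u_equiv_sum:
  "(\<And>x. x \<in> A \<Longrightarrow> u_equiv n (f x) (g x)) \<Longrightarrow> u_equiv n (\<Sum>x\<in>A. f x) (\<Sum>x\<in>A. g x)"
  unfolding u_equiv_def by (simp add: rel_ideal_sum flip: sum_subtractf)

lemma u_equiv_scal_word_append:
  assumes "u_equiv n (u_word a) (scal c * u_word b)" "set e \<subseteq> {..<n}"
  shows "u_equiv n (u_word (a @ e)) (scal c * u_word (b @ e))"
  using u_equiv_mult[OF assms(1) free_ualg_one free_ualg_single[OF assms(2)], of 1]
  by (simp add: u_word_append mult.assoc)

lemma u_equiv_word_append: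
  "u_equiv n (u_word a) (u_word b) \<Longrightarrow> set e \<subseteq> {..<n} \<Longrightarrow> u_equiv n (u_word (a @ e)) (u_word (b @ e))"
  using u_equiv_scal_word_append[of n a 1 b e] by (simp add: scal_mult_single)

lemma hecke_relation_u_equiv:
  assumes "hecke_relation n r s d" "set a \<subseteq> {..<n}"
  shows "u_equiv n (u_word (a @ r)) (scal (xbeta ^ d) * u_word (a @ s))"
proof -
  have "relator r s d \<in> relators n"
    using assms(1) by (auto simp: relators_eq)
  then have "u_word a * relator r s d * 1 \<in> rel_ideal n"
    using assms(2) by (intro rel_ideal.gen free_ualg_single free_ualg_one)
  then show ?thesis
    by (simp add: u_equiv_def relator_def right_diff_distrib scal_mult_single u_word_append)
      (simp add: scal_mult_single mult_single plus_uword_def)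
qed

section \<open>Monomial modules over the algebra of the generators\<close>

text \<open>A step function sends a basis vector \<open>x\<close> and a letter \<open>i\<close> to \<open>Some (d, y)\<close> if
  \<open>x u\<^sub>i = \<beta>\<^sup>d y\<close>, and to \<open>None\<close> if \<open>x u\<^sub>i = 0\<close>.\<close>

type_synonym 'x scaled = "(nat \<times> 'x) option"

definition beta_shift :: "nat \<Rightarrow> 'x scaled \<Rightarrow> 'x scaled" where
  "beta_shift d = map_option (apfst ((+) d))"

lemma beta_shift_simps [simp]:
  "beta_shift d None = None"
  "beta_shift d (Some (k, x)) = Some (d + k, x)"
  "beta_shift 0 p = p"
  by (cases p; simp add: beta_shift_def apfst_def map_prod_def)+

lemma beta_shift_eq_Some_iff [simp]:
  "beta_shift d p = Some (k, x) \<longleftrightarrow> (\<exists>e. p = Some (e, x) \<and> k = d + e)"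
  by (cases p) (auto simp: beta_shift_def)

lemma beta_shift_beta_shift: "beta_shift d (beta_shift e p) = beta_shift (d + e) p"
  by (cases p) (auto simp: beta_shift_def)

fun act :: "('x \<Rightarrow> nat \<Rightarrow> 'x scaled) \<Rightarrow> 'x \<Rightarrow> nat list \<Rightarrow> 'x scaled" where
  "act step x [] = Some (0, x)"
| "act step x (i # a) = (case step x i of None \<Rightarrow> None | Some (d, y) \<Rightarrow> beta_shift d (act step y a))"

lemma act_append:
  "act step x (a @ b) =
    (case act step x a of None \<Rightarrow> None | Some (d, y) \<Rightarrow> beta_shift d (act step y b))"
  by (induction a arbitrary: x) (auto split: option.split simp: beta_shift_beta_shift)

lemma act_snoc_eq_Some_iff:
  "act step x (a @ [i]) = Some (k, z) \<longleftrightarrow>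
    (\<exists>d e y. act step x a = Some (d, y) \<and> step y i = Some (e, z) \<and> k = d + e)"
  by (auto simp: act_append split: option.split)

definition act_coeff :: "('x \<Rightarrow> nat \<Rightarrow> 'x scaled) \<Rightarrow> 'x \<Rightarrow> 'x \<Rightarrow> uword \<Rightarrow> xpoly" where
  "act_coeff step x y u =
    (case act step x (letters u) of None \<Rightarrow> 0 | Some (k, z) \<Rightarrow> if z = y then xbeta ^ k else 0)"

lemma act_coeff_eq_1_iff: "act_coeff step x y (UWord a) = 1 \<longleftrightarrow> act step x a = Some (0, y)"
  by (auto simp: act_coeff_def xbeta_power_eq_1_iff split: option.split)

locale hecke_module =
  fixes n :: nat and X :: "'x set" and step :: "'x \<Rightarrow> nat \<Rightarrow> 'x scaled"
  assumes step_closed: "x \<in> X \<Longrightarrow> i < n \<Longrightarrow> step x i = Some (d, y) \<Longrightarrow> y \<in> X"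
    and step_relation: "x \<in> X \<Longrightarrow> hecke_relation n r s d \<Longrightarrow> act step x r = beta_shift d (act step x s)"
begin

lemma act_closed: "x \<in> X \<Longrightarrow> set a \<subseteq> {..<n} \<Longrightarrow> act step x a = Some (k, y) \<Longrightarrow> y \<in> X"
  by (induction a arbitrary: k y rule: rev_induct)
    (auto simp: act_snoc_eq_Some_iff intro: step_closed)

lemma act_relation:
  assumes "x \<in> X" "set a \<subseteq> {..<n}" "hecke_relation n r s d"
  shows "act step x (a @ r @ b) = beta_shift d (act step x (a @ s @ b))"
proof (cases "act step x a")
  case None
  then show ?thesis by (simp add: act_append)
next
  case (Some p)
  obtain k y where p_eq: "p = (k, y)" by fastforce
  have "y \<in> X"
    using act_closed[OF assms(1,2)] Some p_eq by simp
  then have "act step y (r @ b) = beta_shift d (act step y (s @ b))"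
    by (simp add: act_append step_relation[OF _ assms(3)] beta_shift_beta_shift split: option.split)
  then show ?thesis
    by (simp add: act_append[of _ _ a] Some p_eq beta_shift_beta_shift add.commute)
qed

lemma act_coeff_relation:
  assumes "x \<in> X" "set (letters a) \<subseteq> {..<n}" "hecke_relation n r s d"
  shows "act_coeff step x y (a + UWord r + b) = xbeta ^ d * act_coeff step x y (a + UWord s + b)"
  by (auto simp: act_coeff_def plus_uword_def act_relation[OF assms] power_add split: option.split)

lemma lin_ext_act_coeff_rel_ideal:
  assumes start: "x \<in> X" and in_ideal: "f \<in> rel_ideal n"
  shows "lin_ext (act_coeff step x y) f = 0"
  using in_ideal
proof induction
  case (gen r p q)
  obtain r' s d where r_eq: "r = relator r' s d" and relation: "hecke_relation n r' s d"
    using gen(1) by (auto simp: relators_eq)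
  let ?P = "\<lambda>a. Poly_Mapping.single a (Poly_Mapping.lookup p a)"
  let ?Q = "\<lambda>b. Poly_Mapping.single b (Poly_Mapping.lookup q b)"
  have summand_vanishes: "lin_ext (act_coeff step x y) (?P a * r * ?Q b) = 0"
    if "a \<in> Poly_Mapping.keys p" for a b
    using act_coeff_relation[OF start free_ualgD[OF gen(2) that] relation]
    by (simp add: r_eq relator_def lin_ext_mult_single lin_ext_diff right_diff_distrib
        scal_mult_single mult_single)
  have "p * r * q = (\<Sum>a\<in>Poly_Mapping.keys p. ?P a) * r * (\<Sum>b\<in>Poly_Mapping.keys q. ?Q b)"
    using poly_mapping_eq_sum_single[of p] poly_mapping_eq_sum_single[of q] by simp
  also have "\<dots> = (\<Sum>b\<in>Poly_Mapping.keys q. \<Sum>a\<in>Poly_Mapping.keys p. ?P a * r * ?Q b)"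
    by (simp add: sum_distrib_left sum_distrib_right)
  finally show ?case
    by (simp add: lin_ext_sum summand_vanishes)
qed (simp_all add: lin_ext_add)

lemma lin_ext_act_coeff_u_equiv:
  assumes "x \<in> X" "u_equiv n f g"
  shows "lin_ext (act_coeff step x y) f = lin_ext (act_coeff step x y) g"
  using lin_ext_act_coeff_rel_ideal[of x "f - g"] assms by (simp add: u_equiv_def lin_ext_diff)

lemma act_u_equiv:
  assumes "x \<in> X" "u_equiv n (u_word a) (u_word b)" "act step x a = Some (0, y)"
  shows "act step x b = Some (0, y)"
proof -
  have "act_coeff step x y (UWord a) = act_coeff step x y (UWord b)"
    using lin_ext_act_coeff_u_equiv[OF assms(1,2), of y] by simp
  with assms(3) show ?thesis
    unfolding act_coeff_eq_1_iff[symmetric] by simp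
qed

end

section \<open>Signed permutations and the Demazure product\<close>

lemma cox_gen_0: "cox_gen 0 x = (if x = 1 then - 1 else if x = - 1 then 1 else x)"
  by (auto simp: cox_gen_def transpose_def)

lemma cox_gen_pos:
  "0 < i \<Longrightarrow> cox_gen i x =
    (if x = int i then int i + 1 else if x = int i + 1 then int i
     else if x = - int i then - int i - 1 else if x = - int i - 1 then - int i else x)"
  by (auto simp: cox_gen_def transpose_def)

lemma cox_gen_fix: "\<bar>x\<bar> \<noteq> int i \<Longrightarrow> \<bar>x\<bar> \<noteq> int i + 1 \<Longrightarrow> cox_gen i x = x"
  by (cases "i = 0") (auto simp: cox_gen_0 cox_gen_pos)

lemma cox_gen_uminus: "cox_gen i (- x) = - cox_gen i x"
  by (cases "i = 0") (auto simp: cox_gen_0 cox_gen_pos)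

lemma cox_gen_involution [simp]: "cox_gen i (cox_gen i x) = x"
  by (cases "i = 0") (auto simp: cox_gen_0 cox_gen_pos)

lemma comp_cox_gen_cancel [simp]: "w \<circ> cox_gen i \<circ> cox_gen i = w"
  by (auto simp: fun_eq_iff)

lemma odd_ext:
  fixes f g :: "int \<Rightarrow> int"
  assumes "\<And>x. f (- x) = - f x" "\<And>x. g (- x) = - g x" "\<And>x. 0 \<le> x \<Longrightarrow> f x = g x"
  shows "f = g"
proof
  fix x show "f x = g x"
    using assms(3)[of x] assms(3)[of "- x"] assms(1,2)[of x] by (cases "0 \<le> x") auto
qed

lemma cox_gen_abs_le: "\<bar>x\<bar> \<le> int i + 1 \<Longrightarrow> \<bar>cox_gen i x\<bar> \<le> int i + 1"
  by (cases "i = 0") (auto simp: cox_gen_0 cox_gen_pos)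

lemma cox_gen_less: "0 < k \<Longrightarrow> k < int j \<Longrightarrow> k < x \<Longrightarrow> k < cox_gen j x"
  by (simp add: cox_gen_pos)

lemma cox_gen_commute_less:
  assumes "int i + 1 < int j"
  shows "cox_gen i \<circ> cox_gen j = cox_gen j \<circ> cox_gen i"
proof (rule odd_ext)
  fix x :: int
  assume "0 \<le> x"
  show "(cox_gen i \<circ> cox_gen j) x = (cox_gen j \<circ> cox_gen i) x"
  proof (cases "x \<le> int i + 1")
    case True
    with \<open>0 \<le> x\<close> have "\<bar>x\<bar> \<le> int i + 1" by simp
    then have "\<bar>cox_gen i x\<bar> < int j" "\<bar>x\<bar> < int j"
      using cox_gen_abs_le[of x i] assms by simp_all
    then show ?thesis by (simp add: cox_gen_fix)
  next
    case False
    then have "int i + 1 < cox_gen j x"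
      using cox_gen_less[of "int i + 1" j x] assms by simp
    with False show ?thesis by (simp add: cox_gen_fix)
  qed
qed (simp_all add: cox_gen_uminus)

lemma cox_gen_commute:
  "\<bar>int i - int j\<bar> > 1 \<Longrightarrow> cox_gen i \<circ> cox_gen j = cox_gen j \<circ> cox_gen i"
  using cox_gen_commute_less[of i j] cox_gen_commute_less[of j i] by (cases "i < j") simp_all

lemma cox_gen_braid3_values:
  assumes "0 < i"
  shows "cox_gen i (int i) = int i + 1" "cox_gen i (int i + 1) = int i"
    "cox_gen i (int i + 2) = int i + 2"
    "cox_gen (Suc i) (int i) = int i" "cox_gen (Suc i) (int i + 1) = int i + 2"
    "cox_gen (Suc i) (int i + 2) = int i + 1"
  using assms by (simp_all add: cox_gen_pos)

lemma cox_gen_braid3: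
  assumes "0 < i"
  shows "cox_gen i \<circ> cox_gen (Suc i) \<circ> cox_gen i = cox_gen (Suc i) \<circ> cox_gen i \<circ> cox_gen (Suc i)"
proof (rule odd_ext)
  fix x :: int
  assume "0 \<le> x"
  show "(cox_gen i \<circ> cox_gen (Suc i) \<circ> cox_gen i) x =
      (cox_gen (Suc i) \<circ> cox_gen i \<circ> cox_gen (Suc i)) x"
  proof (cases "x \<in> {int i, int i + 1, int i + 2}")
    case True
    then show ?thesis
      by (elim insertE emptyE) (simp_all only: comp_apply cox_gen_braid3_values[OF assms])
  next
    case False
    with \<open>0 \<le> x\<close> have "cox_gen i x = x" "cox_gen (Suc i) x = x"
      by (auto intro!: cox_gen_fix)
    then show ?thesis by simp
  qed
qed (simp_all add: cox_gen_uminus)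

lemma cox_gen_braid4_values:
  "cox_gen 0 0 = 0" "cox_gen 0 1 = - 1" "cox_gen 0 (- 1) = 1"
  "cox_gen 0 2 = 2" "cox_gen 0 (- 2) = - 2"
  "cox_gen 1 0 = 0" "cox_gen 1 1 = 2" "cox_gen 1 2 = 1"
  "cox_gen 1 (- 1) = - 2" "cox_gen 1 (- 2) = - 1"
  by (simp_all add: cox_gen_0 cox_gen_pos)

lemma cox_gen_braid4:
  "cox_gen 1 \<circ> cox_gen 0 \<circ> cox_gen 1 \<circ> cox_gen 0 = cox_gen 0 \<circ> cox_gen 1 \<circ> cox_gen 0 \<circ> cox_gen 1"
proof (rule odd_ext)
  fix x :: int
  assume "0 \<le> x"
  show "(cox_gen 1 \<circ> cox_gen 0 \<circ> cox_gen 1 \<circ> cox_gen 0) x =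
      (cox_gen 0 \<circ> cox_gen 1 \<circ> cox_gen 0 \<circ> cox_gen 1) x"
  proof (cases "x \<in> {1, 2}")
    case True
    then show ?thesis
      by (elim insertE emptyE) (simp_all only: comp_apply cox_gen_braid4_values)
  next
    case False
    with \<open>0 \<le> x\<close> have "cox_gen 0 x = x" "cox_gen 1 x = x"
      by (auto simp: cox_gen_0 cox_gen_pos)
    then show ?thesis by simp
  qed
qed (simp_all add: cox_gen_uminus)

lemma signed_perms_uminus: "w \<in> signed_perms n \<Longrightarrow> w (- x) = - w x"
  by (simp add: signed_perms_def)

lemma signed_perms_eq_iff: "w \<in> signed_perms n \<Longrightarrow> w x = w y \<longleftrightarrow> x = y"
  by (auto simp: signed_perms_def inj_eq[OF permutes_inj])

lemma signed_perms_0: "w \<in> signed_perms n \<Longrightarrow> w 0 = 0"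
  using signed_perms_uminus[of w n 0] by simp

lemma signed_perms_eq_0_iff: "w \<in> signed_perms n \<Longrightarrow> w x = 0 \<longleftrightarrow> x = 0"
  using signed_perms_eq_iff[of w n x 0] signed_perms_0[of w n] by simp

lemma signed_perms_eq_uminus_iff: "w \<in> signed_perms n \<Longrightarrow> w x = - w y \<longleftrightarrow> x = - y"
  using signed_perms_eq_iff[of w n x "- y"] signed_perms_uminus[of w n y] by simp

lemma signed_perms_outside: "w \<in> signed_perms n \<Longrightarrow> int n < \<bar>x\<bar> \<Longrightarrow> w x = x"
  by (rule permutes_not_in[of w "{- int n..int n} - {0}"]) (auto simp: signed_perms_def)

lemma signed_perms_abs_le:
  assumes "w \<in> signed_perms n" "\<bar>x\<bar> \<le> int n"
  shows "\<bar>w x\<bar> \<le> int n"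
proof (rule ccontr)
  assume "\<not> ?thesis"
  then have "w (w x) = w x"
    by (intro signed_perms_outside[OF assms(1)]) simp
  with assms \<open>\<not> ?thesis\<close> show False
    by (simp add: signed_perms_eq_iff)
qed

lemma id_signed_perms: "id \<in> signed_perms n"
  by (simp add: signed_perms_def permutes_id)

lemma comp_signed_perms:
  "v \<in> signed_perms n \<Longrightarrow> w \<in> signed_perms n \<Longrightarrow> v \<circ> w \<in> signed_perms n"
  by (auto simp: signed_perms_def intro: permutes_compose)

lemma cox_gen_signed_perms:
  assumes "i < n"
  shows "cox_gen i \<in> signed_perms n"
proof -
  have "\<exists>!x. cox_gen i x = y" for y
    by (metis cox_gen_involution)
  moreover have "cox_gen i x = x" if "x \<notin> {- int n..int n} - {0}" for x
    using that assms by (cases "i = 0") (auto simp: cox_gen_0 cox_gen_pos)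
  ultimately show ?thesis
    by (auto simp: signed_perms_def permutes_def cox_gen_uminus)
qed

lemma comp_cox_gen_signed_perms:
  "w \<in> signed_perms n \<Longrightarrow> i < n \<Longrightarrow> w \<circ> cox_gen i \<in> signed_perms n"
  by (intro comp_signed_perms cox_gen_signed_perms)

lemma finite_signed_perms: "finite (signed_perms n)"
  by (rule finite_subset[OF _ finite_permutations[of "{- int n..int n} - {0}"]])
    (auto simp: signed_perms_def)

lemma word_perm_Nil [simp]: "word_perm [] = id"
  by (simp add: word_perm_def)

lemma word_perm_snoc [simp]: "word_perm (a @ [i]) = word_perm a \<circ> cox_gen i"
proof (induction a)
  case (Cons j a)
  then show ?case by (simp add: word_perm_def comp_assoc)
qed (simp add: word_perm_def)

lemma word_perm_signed_perms:
  "set a \<subseteq> {..<n} \<Longrightarrow> word_perm a \<in> signed_perms n"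
  by (induction a rule: rev_induct) (auto intro: id_signed_perms comp_cox_gen_signed_perms)

text \<open>Every signed permutation fixes \<open>0\<close>, so the case \<open>i = 0\<close> reads \<open>w 1 < 0\<close>.\<close>

definition descent :: "nat \<Rightarrow> (int \<Rightarrow> int) \<Rightarrow> bool" where
  "descent i w \<longleftrightarrow> w (int i + 1) < w (int i)"

lemma not_descent_id: "\<not> descent i id"
  by (simp add: descent_def)

lemma descent_comp_cox_gen:
  assumes "w \<in> signed_perms n"
  shows "descent i (w \<circ> cox_gen i) \<longleftrightarrow> \<not> descent i w"
proof (cases "i = 0")
  case True
  then show ?thesis
    using signed_perms_eq_0_iff[OF assms, of 1]
    by (auto simp: descent_def cox_gen_0 signed_perms_0[OF assms] signed_perms_uminus[OF assms])
next
  case False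
  then show ?thesis
    using signed_perms_eq_iff[OF assms, of "int i" "int i + 1"]
    by (auto simp: descent_def cox_gen_pos)
qed

definition demazure_step :: "(int \<Rightarrow> int) \<Rightarrow> nat \<Rightarrow> (int \<Rightarrow> int) scaled" where
  "demazure_step w i = Some (if descent i w then (1, w) else (0, w \<circ> cox_gen i))"

lemma demazure_step_signed_perms:
  "w \<in> signed_perms n \<Longrightarrow> i < n \<Longrightarrow> demazure_step w i = Some (d, v) \<Longrightarrow> v \<in> signed_perms n"
  by (auto simp: demazure_step_def comp_cox_gen_signed_perms split: if_splits)

lemma demazure_braid3:
  assumes signed: "w \<in> signed_perms n" and positive: "0 < i"
  shows "act demazure_step w [i, Suc i, i] = act demazure_step w [Suc i, i, Suc i]"
proof -
  have "w (int i) \<noteq> w (int i + 1)" "w (int i) \<noteq> w (int i + 2)" "w (int i + 1) \<noteq> w (int i + 2)"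
    by (simp_all add: signed_perms_eq_iff[OF signed])
  moreover have "w \<circ> cox_gen i \<circ> cox_gen (Suc i) \<circ> cox_gen i
      = w \<circ> cox_gen (Suc i) \<circ> cox_gen i \<circ> cox_gen (Suc i)"
    using cox_gen_braid3[OF positive] by (simp add: comp_assoc)
  moreover have positions: "1 + int i = int i + 1" "int i + 1 + 1 = int i + 2"
    by simp_all
  ultimately show ?thesis
    by (cases "w (int i) < w (int i + 1)"; cases "w (int i) < w (int i + 2)";
        cases "w (int i + 1) < w (int i + 2)")
      (simp_all add: demazure_step_def descent_def cox_gen_braid3_values[OF positive] positions)
qed

lemma demazure_braid4:
  assumes signed: "w \<in> signed_perms n"
  shows "act demazure_step w [1, 0, 1, 0] = act demazure_step w [0, 1, 0, 1]"
proof -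
  have "w 1 \<noteq> 0" "w 2 \<noteq> 0" "w 1 \<noteq> w 2" "w 1 \<noteq> - w 2"
    by (simp_all add: signed_perms_eq_0_iff[OF signed] signed_perms_eq_iff[OF signed]
        signed_perms_eq_uminus_iff[OF signed])
  moreover have "w (- 1) = - w 1" "w (- 2) = - w 2" "w 0 = 0"
    by (simp_all add: signed_perms_uminus[OF signed] signed_perms_0[OF signed])
  moreover have "w \<circ> cox_gen 1 \<circ> cox_gen 0 \<circ> cox_gen 1 \<circ> cox_gen 0
      = w \<circ> cox_gen 0 \<circ> cox_gen 1 \<circ> cox_gen 0 \<circ> cox_gen 1"
    using cox_gen_braid4 by (simp add: comp_assoc)
  ultimately show ?thesis
    by (cases "w 1 < 0"; cases "w 2 < 0"; cases "w 1 < w 2"; cases "w 1 < - w 2")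
      (simp_all add: demazure_step_def descent_def cox_gen_braid4_values del: One_nat_def)
qed

lemma descent_comp_cox_gen_commute:
  "\<bar>int i - int j\<bar> > 1 \<Longrightarrow> descent i (w \<circ> cox_gen j) \<longleftrightarrow> descent i w"
  by (simp add: descent_def cox_gen_fix)

lemma demazure_commute:
  assumes "\<bar>int i - int j\<bar> > 1"
  shows "act demazure_step w [i, j] = act demazure_step w [j, i]"
proof -
  have "\<bar>int j - int i\<bar> > 1" "w \<circ> cox_gen i \<circ> cox_gen j = w \<circ> cox_gen j \<circ> cox_gen i"
    using assms cox_gen_commute[OF assms] by (simp_all add: comp_assoc)
  with assms show ?thesis
    by (simp add: demazure_step_def descent_comp_cox_gen_commute)
qed

interpretation demazure: hecke_module n "signed_perms n" demazure_step for n
proof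
  fix w r s d
  assume signed: "w \<in> signed_perms n" and "hecke_relation n r s d"
  from this(2) show "act demazure_step w r = beta_shift d (act demazure_step w s)"
  proof cases
    case (quadratic i)
    then show ?thesis
      using descent_comp_cox_gen[OF signed] by (simp add: demazure_step_def)
  next
    case braid4
    then show ?thesis using demazure_braid4[OF signed] by simp
  next
    case (braid3 i)
    then show ?thesis using demazure_braid3[OF signed, of i] by simp
  next
    case (commute i j)
    then show ?thesis using demazure_commute[of i j w] by simp
  qed
qed (rule demazure_step_signed_perms)

lemma act_demazure_total: "\<exists>k v. act demazure_step w a = Some (k, v)"
  by (induction a arbitrary: w) (fastforce simp: demazure_step_def)+

section \<open>Reduced words\<close>

definition ascending_word :: "nat \<Rightarrow> (int \<Rightarrow> int) \<Rightarrow> nat list \<Rightarrow> bool" where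
  "ascending_word n w a \<longleftrightarrow> set a \<subseteq> {..<n} \<and> act demazure_step id a = Some (0, w)"

lemma ascending_word_signed_perms: "ascending_word n w a \<Longrightarrow> w \<in> signed_perms n"
  using demazure.act_closed[OF id_signed_perms] by (auto simp: ascending_word_def)

lemma ascending_word_Nil_iff: "ascending_word n w [] \<longleftrightarrow> w = id"
  by (auto simp: ascending_word_def)

lemma ascending_word_append:
  "ascending_word n v a \<Longrightarrow> set b \<subseteq> {..<n} \<Longrightarrow> act demazure_step v b = Some (0, w) \<Longrightarrow>
    ascending_word n w (a @ b)"
  by (auto simp: ascending_word_def act_append)

lemma demazure_step_eq_Some_0_iff:
  "w \<in> signed_perms n \<Longrightarrow> demazure_step w i = Some (0, v) \<longleftrightarrow> descent i v \<and> w = v \<circ> cox_gen i"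
  using descent_comp_cox_gen[of w n i] by (auto simp: demazure_step_def)

lemma ascending_word_snoc_iff:
  "ascending_word n w (a @ [i]) \<longleftrightarrow> i < n \<and> descent i w \<and> ascending_word n (w \<circ> cox_gen i) a"
  (is "?snoc \<longleftrightarrow> ?split")
proof
  assume ?snoc
  then obtain v where split: "ascending_word n v a" "demazure_step v i = Some (0, w)" and "i < n"
    by (auto simp: ascending_word_def act_snoc_eq_Some_iff)
  then show ?split
    using demazure_step_eq_Some_0_iff[OF ascending_word_signed_perms[OF split(1)]] by simp
next
  assume ?split
  moreover from this have "demazure_step (w \<circ> cox_gen i) i = Some (0, w)"
    using demazure_step_eq_Some_0_iff[OF ascending_word_signed_perms] by blast
  ultimately show ?snoc
    by (auto simp: ascending_word_def act_snoc_eq_Some_iff)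
qed

lemma ascending_word_snoc:
  assumes "ascending_word n w a" "i < n" "\<not> descent i w"
  shows "ascending_word n (w \<circ> cox_gen i) (a @ [i])"
  using assms descent_comp_cox_gen[OF ascending_word_signed_perms[OF assms(1)]]
  by (simp add: ascending_word_snoc_iff)

lemma ascending_word_id_iff: "ascending_word n id a \<longleftrightarrow> a = []"
  by (cases a rule: rev_cases)
    (auto simp: ascending_word_Nil_iff ascending_word_snoc_iff not_descent_id)

lemma word_perm_ascending_word: "ascending_word n w a \<Longrightarrow> word_perm a = w"
proof (induction a arbitrary: w rule: rev_induct)
  case Nil
  then show ?case by (simp add: ascending_word_Nil_iff)
next
  case (snoc i a)
  then have "word_perm a = w \<circ> cox_gen i"
    by (metis ascending_word_snoc_iff)
  then show ?case
    by (simp only: word_perm_snoc comp_cox_gen_cancel)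
qed

lemma strictly_increasing_eq_of_nat:
  fixes f :: "nat \<Rightarrow> int"
  assumes zero: "f 0 = 0" and bound: "f n \<le> int n" and increasing: "\<And>i. i < n \<Longrightarrow> f i < f (Suc i)"
  shows "i \<le> n \<Longrightarrow> f i = int i"
proof (rule antisym)
  assume "i \<le> n"
  then show "f i \<le> int i"
  proof (induction i rule: inc_induct)
    case (step i)
    then show ?case using increasing[of i] by simp
  qed (rule bound)
  show "int i \<le> f i" using \<open>i \<le> n\<close>
  proof (induction i)
    case (Suc i)
    then show ?case using increasing[of i] by simp
  qed (simp add: zero)
qed

lemma no_descent_imp_id:
  assumes signed: "w \<in> signed_perms n" and no_descent: "\<And>i. i < n \<Longrightarrow> \<not> descent i w"
  shows "w = id"
proof (rule odd_ext)
  fix x :: int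
  assume "0 \<le> x"
  have increasing: "w (int i) < w (int (Suc i))" if "i < n" for i
    using no_descent[OF that] signed_perms_eq_iff[OF signed, of "int i" "int i + 1"]
    by (simp add: descent_def add.commute)
  have bound: "w (int n) \<le> int n"
    using signed_perms_abs_le[OF signed, of "int n"] by simp
  have "w (int 0) = 0"
    by (simp add: signed_perms_0[OF signed])
  then have "w (int i) = int i" if "i \<le> n" for i
    using bound increasing that by (rule strictly_increasing_eq_of_nat)
  from this[of "nat x"] show "w x = id x"
    using \<open>0 \<le> x\<close> signed_perms_outside[OF signed, of x] by (cases "x \<le> int n") simp_all
qed (simp_all add: signed_perms_uminus[OF signed])

definition perm_weight :: "nat \<Rightarrow> (int \<Rightarrow> int) \<Rightarrow> int" where
  "perm_weight n w = (\<Sum>k = 1..n. int k * w (int k))"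

lemma descent_perm_weight_less:
  assumes signed: "w \<in> signed_perms n" and "i < n" "descent i w"
  shows "perm_weight n w < perm_weight n (w \<circ> cox_gen i)"
proof -
  let ?change = "\<lambda>k. int k * ((w \<circ> cox_gen i) (int k) - w (int k))"
  have "(\<Sum>k = 1..n. ?change k) = (\<Sum>k \<in> {i, Suc i} - {0}. ?change k)"
    using \<open>i < n\<close>
    by (intro sum.mono_neutral_right) (auto intro!: cox_gen_fix arg_cong[of _ _ w])
  also have "\<dots> > 0"
  proof (cases "i = 0")
    case True
    then have "{i, Suc i} - {0} = {Suc 0}" by auto
    then show ?thesis
      using assms(3) True
      by (simp add: cox_gen_0 descent_def signed_perms_0[OF signed] signed_perms_uminus[OF signed])
  next
    case False
    then have "{i, Suc i} - {0} = {i, Suc i}" by auto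
    then show ?thesis
      using assms(3) False cox_gen_braid3_values(1,2)[of i]
      by (simp add: descent_def add.commute algebra_simps)
  qed
  finally show ?thesis
    by (simp add: perm_weight_def right_diff_distrib sum_subtractf)
qed

lemma exists_ascending_word: "w \<in> signed_perms n \<Longrightarrow> \<exists>a. ascending_word n w a"
proof (induction "card {v \<in> signed_perms n. perm_weight n w < perm_weight n v}" arbitrary: w
    rule: less_induct)
  case less
  show ?case
  proof (cases "\<exists>i<n. descent i w")
    case True
    then obtain i where descent: "i < n" "descent i w" by auto
    have closer: "w \<circ> cox_gen i \<in> signed_perms n"
      using less.prems descent(1) by (rule comp_cox_gen_signed_perms)
    have "{v \<in> signed_perms n. perm_weight n (w \<circ> cox_gen i) < perm_weight n v}
        \<subset> {v \<in> signed_perms n. perm_weight n w < perm_weight n v}"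
      using descent_perm_weight_less[OF less.prems descent] closer by auto
    then obtain a where "ascending_word n (w \<circ> cox_gen i) a"
      using less.hyps[OF psubset_card_mono closer] finite_signed_perms by auto
    then show ?thesis
      using descent ascending_word_snoc_iff by blast
  next
    case False
    then show ?thesis
      using no_descent_imp_id[OF less.prems] ascending_word_id_iff by auto
  qed
qed

lemma demazure_snoc_descent:
  assumes "w \<in> signed_perms n" "i < n" "descent i w"
    "act demazure_step v a = Some (0, w \<circ> cox_gen i)"
  shows "act demazure_step v (a @ [i]) = Some (0, w)"
  using assms demazure_step_eq_Some_0_iff[OF comp_cox_gen_signed_perms[OF assms(1,2)]]
  by (simp add: act_snoc_eq_Some_iff)

lemma descents_commute:
  assumes signed: "w \<in> signed_perms n" and descent_i: "i < n" "descent i w"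
    and descent_j: "j < n" "descent j w"
    and far: "\<bar>int j - int i\<bar> > 1"
  shows "act demazure_step (w \<circ> cox_gen i \<circ> cox_gen j) [j, i] = Some (0, w)"
proof -
  note signed_i = comp_cox_gen_signed_perms[OF signed descent_i(1)]
  have "descent j (w \<circ> cox_gen i)"
    using descent_j far by (simp add: descent_comp_cox_gen_commute)
  with descent_i descent_j show ?thesis
    using demazure_snoc_descent[OF signed descent_i(1), of _ "[j]"]
      demazure_snoc_descent[OF signed_i descent_j(1), of _ "[]"]
    by simp
qed

lemma descents_braid3:
  assumes signed: "w \<in> signed_perms n"
    and descents: "0 < i" "Suc i < n" "descent i w" "descent (Suc i) w"
  shows "act demazure_step (w \<circ> cox_gen i \<circ> cox_gen (Suc i) \<circ> cox_gen i) [i, Suc i, i] =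
    Some (0, w)"
proof -
  have "i < n" using descents by simp
  note signed_i = comp_cox_gen_signed_perms[OF signed \<open>i < n\<close>]
  note signed_ij = comp_cox_gen_signed_perms[OF signed_i descents(2)]
  have positions: "1 + int i = int i + 1" "int i + 1 + 1 = int i + 2" by simp_all
  have "w (int i + 1) < w (int i)" "w (int i + 2) < w (int i + 1)"
    using descents by (simp_all add: descent_def positions)
  then have "descent (Suc i) (w \<circ> cox_gen i)" "descent i (w \<circ> cox_gen i \<circ> cox_gen (Suc i))"
    by (simp_all add: descent_def positions cox_gen_braid3_values[OF descents(1)])
  with descents show ?thesis
    using demazure_snoc_descent[OF signed \<open>i < n\<close>, of _ "[i, Suc i]"]
      demazure_snoc_descent[OF signed_i descents(2), of _ "[i]"]
      demazure_snoc_descent[OF signed_ij \<open>i < n\<close>, of _ "[]"]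
    by simp
qed

lemma descents_braid4:
  assumes signed: "w \<in> signed_perms n" and rank: "1 < n" and descents: "descent 0 w" "descent 1 w"
  shows "act demazure_step (w \<circ> cox_gen 0 \<circ> cox_gen 1 \<circ> cox_gen 0 \<circ> cox_gen 1) [1, 0, 1, 0] =
    Some (0, w)"
proof -
  have "0 < n" using rank by simp
  note signed_0 = comp_cox_gen_signed_perms[OF signed \<open>0 < n\<close>]
  note signed_01 = comp_cox_gen_signed_perms[OF signed_0 rank]
  note signed_010 = comp_cox_gen_signed_perms[OF signed_01 \<open>0 < n\<close>]
  have "w 1 < 0" "w 2 < w 1" "w (- 1) = - w 1" "w (- 2) = - w 2" "w 0 = 0"
    using descents
    by (simp_all add: descent_def signed_perms_0[OF signed] signed_perms_uminus[OF signed])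
  then have "descent 1 (w \<circ> cox_gen 0)" "descent 0 (w \<circ> cox_gen 0 \<circ> cox_gen 1)"
    "descent 1 (w \<circ> cox_gen 0 \<circ> cox_gen 1 \<circ> cox_gen 0)"
    by (simp_all add: descent_def cox_gen_braid4_values del: One_nat_def)
  with rank descents show ?thesis
    using demazure_snoc_descent[OF signed \<open>0 < n\<close>, of _ "[1, 0, 1]"]
      demazure_snoc_descent[OF signed_0 rank, of _ "[1, 0]"]
      demazure_snoc_descent[OF signed_01 \<open>0 < n\<close>, of _ "[1]"]
      demazure_snoc_descent[OF signed_010 rank, of _ "[]"]
    by simp
qed

lemma exists_braid_of_descents:
  assumes signed: "w \<in> signed_perms n" and less: "i < j" "j < n"
    and descents: "descent i w" "descent j w"
  obtains v r s where "v \<in> signed_perms n" "hecke_relation n (r @ [i]) (s @ [j]) 0"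
    "act demazure_step v (r @ [i]) = Some (0, w)"
proof -
  have "i < n" using less by simp
  note closed = comp_cox_gen_signed_perms[OF _ \<open>i < n\<close>] comp_cox_gen_signed_perms[OF _ less(2)]
  consider (far) "1 < \<bar>int j - int i\<bar>" | (braid3) "j = Suc i" "0 < i" | (braid4) "i = 0" "j = 1"
    using less by linarith
  then show thesis
  proof cases
    case far
    then have "hecke_relation n ([j] @ [i]) ([i] @ [j]) 0"
      using hecke_relation.commute[of j n i] less by simp
    then show thesis
      using descents_commute[OF signed \<open>i < n\<close> descents(1) less(2) descents(2) far]
      by (intro that[of "w \<circ> cox_gen i \<circ> cox_gen j" "[j]" "[i]"] closed signed)
        (simp_all only: append.simps)
  next
    case braid3
    then have "hecke_relation n ([i, j] @ [i]) ([j, i] @ [j]) 0"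
      using hecke_relation.braid3[of i n] less by simp
    then show thesis
      using descents_braid3[OF signed, of i] braid3 less descents
      by (intro that[of "w \<circ> cox_gen i \<circ> cox_gen j \<circ> cox_gen i" "[i, j]" "[j, i]"] closed signed)
        (simp_all only: append.simps)
  next
    case braid4
    then have "hecke_relation n ([j, i, j] @ [i]) ([i, j, i] @ [j]) 0"
      using hecke_relation.braid4[of n] less by simp
    then show thesis
      using descents_braid4[OF signed] braid4 less descents
      by (intro that[of "w \<circ> cox_gen i \<circ> cox_gen j \<circ> cox_gen i \<circ> cox_gen j" "[j, i, j]" "[i, j, i]"]
          closed signed)
        (simp_all only: append.simps)
  qed
qed

lemma hecke_relation_length: "hecke_relation n r s d \<Longrightarrow> length r = length s + d"
  by (erule hecke_relation.cases) auto

lemma ascending_words_of_descent_pair: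
  assumes "w \<in> signed_perms n" "i < j" "j < n" "descent i w" "descent j w"
  shows "\<exists>a b. ascending_word n (w \<circ> cox_gen i) a \<and> ascending_word n (w \<circ> cox_gen j) b \<and>
    length a = length b \<and> u_equiv n (u_word (a @ [i])) (u_word (b @ [j]))"
proof -
  obtain v r s where start: "v \<in> signed_perms n" and braid: "hecke_relation n (r @ [i]) (s @ [j]) 0"
    and act_r: "act demazure_step v (r @ [i]) = Some (0, w)"
    using exists_braid_of_descents[OF assms] .
  then have act_s: "act demazure_step v (s @ [j]) = Some (0, w)"
    using demazure.step_relation[OF start braid] by simp
  obtain c where prefix: "ascending_word n v c"
    using exists_ascending_word[OF start] by blast
  have "ascending_word n w (c @ r @ [i])" "ascending_word n w (c @ s @ [j])"
    using ascending_word_append[OF prefix] act_r act_s hecke_relation_letters[OF braid] by blast+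
  then have "ascending_word n (w \<circ> cox_gen i) (c @ r)" "ascending_word n (w \<circ> cox_gen j) (c @ s)"
    using ascending_word_snoc_iff[of n w "c @ r" i] ascending_word_snoc_iff[of n w "c @ s" j]
    by simp_all
  moreover have "u_equiv n (u_word (c @ r @ [i])) (u_word (c @ s @ [j]))"
    using hecke_relation_u_equiv[OF braid] prefix by (simp add: ascending_word_def scal_mult_single)
  moreover have "length (c @ r) = length (c @ s)"
    using hecke_relation_length[OF braid] by simp
  ultimately show ?thesis
    by (metis append_assoc)
qed

lemma ascending_words_of_descents:
  assumes signed: "w \<in> signed_perms n" and descents: "i < n" "j < n" "descent i w" "descent j w"
  obtains a b where "ascending_word n (w \<circ> cox_gen i) a" "ascending_word n (w \<circ> cox_gen j) b"
    "length a = length b" "u_equiv n (u_word (a @ [i])) (u_word (b @ [j]))"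
proof (cases i j rule: linorder_cases)
  case less
  then show thesis
    using ascending_words_of_descent_pair[OF signed less] descents that by blast
next
  case equal
  obtain a where "ascending_word n (w \<circ> cox_gen i) a"
    using exists_ascending_word comp_cox_gen_signed_perms[OF signed descents(1)] by blast
  with equal that[of a a] show thesis by simp
next
  case greater
  then show thesis
    using ascending_words_of_descent_pair[OF signed greater] descents that u_equiv_sym by metis
qed

lemma ascending_words_equiv:
  "ascending_word n w a \<Longrightarrow> ascending_word n w b \<Longrightarrow>
    length a = length b \<and> u_equiv n (u_word a) (u_word b)"
proof (induction "length a" arbitrary: w a b rule: less_induct)
  case less
  show ?case
  proof (cases "w = id")
    case True
    with less.prems show ?thesis by (simp add: ascending_word_id_iff)
  next
    case False
    with less.prems obtain a' i b' j where a_eq: "a = a' @ [i]" and b_eq: "b = b' @ [j]"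
      by (metis ascending_word_Nil_iff rev_exhaust)
    have last_a: "i < n" "descent i w" "ascending_word n (w \<circ> cox_gen i) a'"
      and last_b: "j < n" "descent j w" "ascending_word n (w \<circ> cox_gen j) b'"
      using less.prems by (simp_all add: a_eq b_eq ascending_word_snoc_iff)
    obtain c d where via_c: "ascending_word n (w \<circ> cox_gen i) c"
      and via_d: "ascending_word n (w \<circ> cox_gen j) d"
      and braid: "length c = length d" "u_equiv n (u_word (c @ [i])) (u_word (d @ [j]))"
      using last_a last_b ascending_word_signed_perms[OF less.prems(1)]
      by (blast elim: ascending_words_of_descents)
    have prefix_a: "length a' = length c \<and> u_equiv n (u_word a') (u_word c)"
      using less.hyps[of a' "w \<circ> cox_gen i" c] last_a(3) via_c by (simp add: a_eq)
    then have prefix_b: "length d = length b' \<and> u_equiv n (u_word d) (u_word b')"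
      using less.hyps[of d "w \<circ> cox_gen j" b'] via_d last_b(3) braid(1) by (simp add: a_eq)
    have "u_equiv n (u_word (a' @ [i])) (u_word (c @ [i]))"
      using prefix_a last_a(1) by (simp add: u_equiv_word_append)
    also note braid(2)
    also have "u_equiv n (u_word (d @ [j])) (u_word (b' @ [j]))"
      using prefix_b last_b(1) by (simp add: u_equiv_word_append)
    finally show ?thesis
      using prefix_a prefix_b braid(1) by (simp add: a_eq b_eq)
  qed
qed

lemma ascending_or_longer:
  "ascending_word n w a \<Longrightarrow> set b \<subseteq> {..<n} \<Longrightarrow> word_perm b = w \<Longrightarrow>
    length a < length b \<or> ascending_word n w b"
proof (induction b arbitrary: w a rule: rev_induct)
  case Nil
  then show ?case by (metis ascending_word_Nil_iff word_perm_Nil)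
next
  case (snoc i b)
  define v where "v = word_perm b"
  have letters: "i < n" "set b \<subseteq> {..<n}" and w_eq: "w = v \<circ> cox_gen i"
    using snoc.prems by (auto simp: v_def)
  obtain c where prefix: "ascending_word n v c"
    using exists_ascending_word[OF word_perm_signed_perms[OF letters(2)]] by (auto simp: v_def)
  have IH: "length c < length b \<or> ascending_word n v b"
    using snoc.IH[OF prefix letters(2)] by (simp add: v_def)
  show ?case
  proof (cases "descent i v")
    case True
    then have "ascending_word n v (a @ [i])"
      using snoc.prems(1) letters(1) unfolding w_eq ascending_word_snoc_iff by blast
    then have "Suc (length a) = length c"
      using ascending_words_equiv[OF _ prefix] by force
    moreover have "length c \<le> length b"
      using IH ascending_words_equiv[OF prefix] by force
    ultimately show ?thesis by simp
  next
    case False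
    with prefix letters(1) have "ascending_word n w (c @ [i])"
      unfolding w_eq by (rule ascending_word_snoc)
    from ascending_words_equiv[OF snoc.prems(1) this] have "length a = Suc (length c)"
      by simp
    with IH show ?thesis
      unfolding w_eq using ascending_word_snoc[OF _ letters(1) False]
      by (metis Suc_less_eq length_append_singleton)
  qed
qed

lemma ascending_word_length_le:
  assumes "ascending_word n w a" "set b \<subseteq> {..<n}" "word_perm b = w"
  shows "length a \<le> length b"
  using ascending_or_longer[OF assms] ascending_words_equiv[OF assms(1)] by force

lemma reduced_word_iff_ascending_word: "reduced_word n w a \<longleftrightarrow> ascending_word n w a"
proof
  assume reduced: "reduced_word n w a"
  then have word: "set a \<subseteq> {..<n}" "word_perm a = w"
    by (simp_all add: reduced_word_def)
  obtain b where ascending: "ascending_word n w b"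
    using exists_ascending_word word_perm_signed_perms[OF word(1)] word(2) by blast
  then have "length a \<le> length b"
    using reduced word_perm_ascending_word[OF ascending]
    by (auto simp: reduced_word_def ascending_word_def)
  then show "ascending_word n w a"
    using ascending_or_longer[OF ascending word] by simp
next
  assume "ascending_word n w a"
  then show "reduced_word n w a"
    using ascending_word_length_le word_perm_ascending_word
    by (auto simp: reduced_word_def ascending_word_def)
qed

section \<open>Coordinates in the quotient algebra\<close>

lemma single_sum: "Poly_Mapping.single x (\<Sum>a\<in>A. g a) = (\<Sum>a\<in>A. Poly_Mapping.single x (g a))"
  by (induction A rule: infinite_finite_induct) (simp_all add: single_add)

lemma u_word_demazure_step_equiv:
  assumes prefix: "ascending_word n v a" and "i < n" and step: "demazure_step v i = Some (d, w)"
    and target: "ascending_word n w b"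
  shows "u_equiv n (u_word (a @ [i])) (scal (xbeta ^ d) * u_word b)"
proof (cases "descent i v")
  case True
  with step have loop: "d = 1" "w = v"
    by (simp_all add: demazure_step_def)
  obtain c where "ascending_word n (v \<circ> cox_gen i) c"
    using exists_ascending_word
      comp_cox_gen_signed_perms[OF ascending_word_signed_perms[OF prefix] \<open>i < n\<close>]
    by blast
  then have "set c \<subseteq> {..<n}" and snoc: "ascending_word n v (c @ [i])"
    using True \<open>i < n\<close> by (simp_all add: ascending_word_snoc_iff) (simp add: ascending_word_def)
  have "u_equiv n (u_word (a @ [i])) (u_word (c @ [i, i]))"
    using u_equiv_word_append[of n a "c @ [i]" "[i]"] ascending_words_equiv[OF prefix snoc] \<open>i < n\<close>
    by simp
  also have "u_equiv n \<dots> (scal xbeta * u_word (c @ [i]))"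
    using hecke_relation_u_equiv[OF quadratic[OF \<open>i < n\<close>] \<open>set c \<subseteq> {..<n}\<close>] by simp
  also have "u_equiv n \<dots> (scal xbeta * u_word b)"
    using ascending_words_equiv[OF snoc, of b] target by (simp add: loop u_equiv_scal)
  finally show ?thesis by (simp add: loop)
next
  case False
  with step have ascent: "d = 0" "w = v \<circ> cox_gen i"
    by (simp_all add: demazure_step_def)
  from prefix \<open>i < n\<close> False have "ascending_word n w (a @ [i])"
    unfolding ascent(2) by (rule ascending_word_snoc)
  from ascending_words_equiv[OF this target] show ?thesis
    by (simp add: ascent(1) scal_mult_single)
qed

lemma u_word_demazure_equiv:
  assumes "set a \<subseteq> {..<n}" "act demazure_step id a = Some (k, w)" "ascending_word n w b"
  shows "u_equiv n (u_word a) (scal (xbeta ^ k) * u_word b)"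
  using assms
proof (induction a arbitrary: k w b rule: rev_induct)
  case Nil
  then have "k = 0" "w = id"
    by (simp_all only: act.simps option.inject prod.inject)
  with Nil.prems(3) have "k = 0" "b = []"
    by (simp_all only: ascending_word_id_iff)
  then show ?case by (simp add: scal_mult_single)
next
  case (snoc i a)
  obtain l d v where act_a: "act demazure_step id a = Some (l, v)"
    and step: "demazure_step v i = Some (d, w)" and "k = l + d"
    using snoc.prems(2) unfolding act_snoc_eq_Some_iff by blast
  have letters: "i < n" "set a \<subseteq> {..<n}"
    using snoc.prems(1) by auto
  obtain c where prefix: "ascending_word n v c"
    using exists_ascending_word demazure.act_closed[OF id_signed_perms letters(2) act_a] by blast
  have "u_equiv n (u_word (a @ [i])) (scal (xbeta ^ l) * u_word (c @ [i]))"
    using u_equiv_scal_word_append[OF snoc.IH[OF letters(2) act_a prefix], of "[i]"] letters(1)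
    by simp
  also have "u_equiv n \<dots> (scal (xbeta ^ l) * (scal (xbeta ^ d) * u_word b))"
    using u_word_demazure_step_equiv[OF prefix letters(1) step snoc.prems(3)] by (rule u_equiv_scal)
  finally show ?case
    by (simp add: \<open>k = l + d\<close> scal_mult_single power_add)
qed

lemma u_perm_eq_u_word:
  assumes "w \<in> signed_perms n"
  obtains a where "ascending_word n w a" "u_perm n w = u_word a"
proof -
  have "\<exists>a. reduced_word n w a"
    using exists_ascending_word[OF assms] by (simp add: reduced_word_iff_ascending_word)
  then have "ascending_word n w (SOME a. reduced_word n w a)"
    unfolding reduced_word_iff_ascending_word by (rule someI_ex)
  then show thesis
    by (rule that) (simp add: u_perm_def prod_list_ugen)
qed

definition expansion :: "nat \<Rightarrow> ualg \<Rightarrow> ((int \<Rightarrow> int) \<Rightarrow> xpoly) \<Rightarrow> bool" where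
  "expansion n f c \<longleftrightarrow> (\<forall>w. w \<notin> signed_perms n \<longrightarrow> c w = 0) \<and>
    u_equiv n f (\<Sum>w\<in>signed_perms n. scal (c w) * u_perm n w)"

lemma expansion_sum:
  assumes "\<And>x. x \<in> A \<Longrightarrow> expansion n (f x) (c x)"
  shows "expansion n (\<Sum>x\<in>A. f x) (\<lambda>w. \<Sum>x\<in>A. c x w)"
proof -
  have "u_equiv n (\<Sum>x\<in>A. f x) (\<Sum>x\<in>A. \<Sum>w\<in>signed_perms n. scal (c x w) * u_perm n w)"
    using assms by (intro u_equiv_sum) (simp add: expansion_def)
  also have "(\<Sum>x\<in>A. \<Sum>w\<in>signed_perms n. scal (c x w) * u_perm n w)
      = (\<Sum>w\<in>signed_perms n. scal (\<Sum>x\<in>A. c x w) * u_perm n w)"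
    by (subst sum.swap) (simp add: scal_def single_sum sum_distrib_right)
  finally show ?thesis
    using assms by (simp add: expansion_def)
qed

lemma expansion_single:
  assumes "set a \<subseteq> {..<n}" "act demazure_step id a = Some (k, w)"
  shows "expansion n (Poly_Mapping.single (UWord a) e) (\<lambda>v. if v = w then e * xbeta ^ k else 0)"
proof -
  have signed: "w \<in> signed_perms n"
    using demazure.act_closed[OF id_signed_perms assms] .
  obtain b where basis: "ascending_word n w b" "u_perm n w = u_word b"
    using u_perm_eq_u_word[OF signed] .
  have "u_equiv n (scal e * u_word a) (scal e * (scal (xbeta ^ k) * u_word b))"
    using u_word_demazure_equiv[OF assms basis(1)] by (rule u_equiv_scal)
  also have "scal e * (scal (xbeta ^ k) * u_word b) = scal (e * xbeta ^ k) * u_perm n w"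
    by (simp add: basis(2) scal_mult_single)
  also have "\<dots> = (\<Sum>v\<in>signed_perms n. if v = w then scal (e * xbeta ^ k) * u_perm n v else 0)"
    using signed by (simp add: finite_signed_perms)
  also have "\<dots> = (\<Sum>v\<in>signed_perms n. scal (if v = w then e * xbeta ^ k else 0) * u_perm n v)"
    by (intro sum.cong refl) (simp add: scal_def)
  finally show ?thesis
    using signed by (auto simp: expansion_def scal_mult_single)
qed

lemma exists_expansion:
  assumes free: "f \<in> free_ualg n"
  shows "\<exists>c. expansion n f c"
proof -
  have "\<exists>c. expansion n (Poly_Mapping.single a (Poly_Mapping.lookup f a)) c"
    if "a \<in> Poly_Mapping.keys f" for a
  proof -
    obtain k w where "act demazure_step id (letters a) = Some (k, w)"
      using act_demazure_total by blast
    from expansion_single[OF free_ualgD[OF free that] this] show ?thesis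
      unfolding uword.collapse by blast
  qed
  then obtain c where "\<And>a. a \<in> Poly_Mapping.keys f \<Longrightarrow>
      expansion n (Poly_Mapping.single a (Poly_Mapping.lookup f a)) (c a)"
    by metis
  then have "expansion n f (\<lambda>w. \<Sum>a\<in>Poly_Mapping.keys f. c a w)"
    by (subst poly_mapping_eq_sum_single[of f]) (rule expansion_sum)
  then show ?thesis by blast
qed

lemma (in hecke_module) expansion_coeff_eq:
  assumes start: "x \<in> X" and signed: "v \<in> signed_perms n"
    and dual: "\<And>w a. ascending_word n w a \<Longrightarrow> act_coeff step x y (UWord a) = of_bool (w = v)"
    and expansion: "expansion n f c"
  shows "c v = lin_ext (act_coeff step x y) f"
proof -
  have "lin_ext (act_coeff step x y) f
      = lin_ext (act_coeff step x y) (\<Sum>w\<in>signed_perms n. scal (c w) * u_perm n w)"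
    using expansion by (intro lin_ext_act_coeff_u_equiv[OF start]) (simp add: expansion_def)
  also have "\<dots> = (\<Sum>w\<in>signed_perms n. if w = v then c w else 0)"
    unfolding lin_ext_sum
  proof (rule sum.cong[OF refl])
    fix w
    assume "w \<in> signed_perms n"
    then obtain a where basis: "ascending_word n w a" "u_perm n w = u_word a"
      by (rule u_perm_eq_u_word)
    show "lin_ext (act_coeff step x y) (scal (c w) * u_perm n w) = (if w = v then c w else 0)"
      unfolding basis(2) scal_mult_single lin_ext_single dual[OF basis(1)] by simp
  qed
  also have "\<dots> = c v"
    using signed by (simp add: finite_signed_perms)
  finally show ?thesis by simp
qed

lemma act_coeff_demazure_dual:
  assumes "ascending_word n w a"
  shows "act_coeff demazure_step id v (UWord a) = of_bool (w = v)"
proof -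
  have "act demazure_step id a = Some (0, w)"
    using assms by (simp only: ascending_word_def)
  then show ?thesis
    by (simp only: act_coeff_def uword.sel option.case prod.case) simp
qed

lemma expansion_unique:
  assumes "expansion n f c" "expansion n f d"
  shows "c = d"
proof
  fix v
  show "c v = d v"
  proof (cases "v \<in> signed_perms n")
    case True
    have "e v = lin_ext (act_coeff demazure_step id v) f" if "expansion n f e" for e
      using id_signed_perms True act_coeff_demazure_dual that by (rule demazure.expansion_coeff_eq)
    from this[OF assms(1)] this[OF assms(2)] show ?thesis by simp
  next
    case False
    with assms show ?thesis by (simp add: expansion_def)
  qed
qed

lemma expansion_u_coeffs:
  assumes "f \<in> free_ualg n"
  shows "expansion n f (u_coeffs n f)"
proof -
  have "u_coeffs n f = (THE c. expansion n f c)"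
    by (simp add: u_coeffs_def expansion_def u_equiv_def)
  moreover have "\<exists>!c. expansion n f c"
    using exists_expansion[OF assms] expansion_unique by blast
  ultimately show ?thesis
    using theI'[of "expansion n f"] by simp
qed

lemma GC_eqI:
  assumes "\<forall>\<^sub>F m in sequentially. Poly_Mapping.lookup (u_coeffs n (C_prod n m) w) \<alpha> = c"
  shows "GC n w \<alpha> = c"
  unfolding GC_def
proof (rule the_equality, rule assms)
  fix d
  assume "\<forall>\<^sub>F m in sequentially. Poly_Mapping.lookup (u_coeffs n (C_prod n m) w) \<alpha> = d"
  with assms have "\<forall>\<^sub>F m :: nat in sequentially. c = d"
    by eventually_elim simp
  then show "d = c" by simp
qed

section \<open>The action on shifted shapes\<close>

text \<open>A shape is encoded by the number \<open>h i\<close> of its boxes on the diagonal of index \<open>i\<close>; the strict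
  partitions with parts at most \<open>n\<close> become the functions that vanish from \<open>n\<close> on and decrease by at
  most one at each step. The function \<open>g\<close> is the inner shape, whose boxes are never removable.\<close>

definition staircase :: "nat \<Rightarrow> (nat \<Rightarrow> nat) \<Rightarrow> bool" where
  "staircase n h \<longleftrightarrow> (\<forall>i. h (Suc i) \<le> h i \<and> h i \<le> Suc (h (Suc i))) \<and> (\<forall>i\<ge>n. h i = 0)"

definition removable :: "(nat \<Rightarrow> nat) \<Rightarrow> nat \<Rightarrow> (nat \<Rightarrow> nat) \<Rightarrow> bool" where
  "removable g i h \<longleftrightarrow> g i < h i \<and> h i = Suc (h (Suc i)) \<and> (i = 0 \<or> h (i - 1) = h i)"

definition addable :: "nat \<Rightarrow> (nat \<Rightarrow> nat) \<Rightarrow> bool" where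
  "addable i h \<longleftrightarrow> h i = h (Suc i) \<and> (i = 0 \<or> h (i - 1) = Suc (h i))"

abbreviation add_box :: "nat \<Rightarrow> (nat \<Rightarrow> nat) \<Rightarrow> nat \<Rightarrow> nat" where
  "add_box i h \<equiv> h(i := Suc (h i))"

abbreviation remove_box :: "nat \<Rightarrow> (nat \<Rightarrow> nat) \<Rightarrow> nat \<Rightarrow> nat" where
  "remove_box i h \<equiv> h(i := h i - 1)"

lemma staircase_Suc_le: "staircase n h \<Longrightarrow> h (Suc i) \<le> h i"
  and staircase_le_Suc: "staircase n h \<Longrightarrow> h i \<le> Suc (h (Suc i))"
  and staircase_eq_0: "staircase n h \<Longrightarrow> n \<le> i \<Longrightarrow> h i = 0"
  by (simp_all add: staircase_def)

lemma staircase_antimono: "staircase n h \<Longrightarrow> antimono h"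
  by (simp add: antimono_iff_le_Suc staircase_Suc_le)

lemma staircase_add_box:
  "staircase n h \<Longrightarrow> i < n \<Longrightarrow> addable i h \<Longrightarrow> staircase n (add_box i h)"
  unfolding staircase_def addable_def by (auto simp: all_conj_distrib)

lemma staircase_remove_box: "staircase n h \<Longrightarrow> removable g i h \<Longrightarrow> staircase n (remove_box i h)"
  unfolding staircase_def removable_def by (auto simp: all_conj_distrib)

lemma removable_less:
  assumes "removable g i h" "staircase n h"
  shows "i < n"
proof (rule ccontr)
  assume "\<not> i < n"
  then have "h i = 0" using staircase_eq_0[OF assms(2)] by simp
  with assms(1) show False by (simp add: removable_def)
qed

lemma removable_not_neighbours:
  assumes "removable g i h" "removable g j h" "i \<noteq> j"
  shows "\<bar>int i - int j\<bar> > 1"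
proof (rule ccontr)
  assume "\<not> ?thesis"
  with assms(3) have "i = Suc j \<or> j = Suc i" by linarith
  then show False using assms(1,2) by (auto simp: removable_def)
qed

lemma addable_not_removable: "addable i h \<Longrightarrow> \<not> removable g i h"
  by (auto simp: addable_def removable_def)

lemma removable_add_box:
  assumes "addable i h" "g \<le> h"
  shows "removable g i (add_box i h)"
  using assms(1) le_funD[OF assms(2), of i] by (auto simp: addable_def removable_def)

lemma addable_remove_box: "removable g i h \<Longrightarrow> addable i (remove_box i h)"
  by (auto simp: addable_def removable_def)

lemma add_remove_box: "removable g i h \<Longrightarrow> add_box i (remove_box i h) = h"
  by (auto simp: removable_def)

lemma remove_box_neq: "removable g i h \<Longrightarrow> remove_box i h \<noteq> h"
  by (auto simp: removable_def fun_eq_iff)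

lemma le_remove_box:
  assumes "g \<le> h" "removable g i h"
  shows "g \<le> remove_box i h"
  using le_funD[OF assms(1)] assms(2) by (auto simp: le_fun_def removable_def)

lemma removable_fun_upd:
  "\<bar>int i - int j\<bar> > 1 \<Longrightarrow> removable g i (h(j := x)) \<longleftrightarrow> removable g i h"
  by (auto simp: removable_def)

lemma addable_fun_upd:
  "\<bar>int i - int j\<bar> > 1 \<Longrightarrow> addable i (h(j := x)) \<longleftrightarrow> addable i h"
  by (auto simp: addable_def)

definition shape_step :: "(nat \<Rightarrow> nat) \<Rightarrow> (nat \<Rightarrow> nat) \<Rightarrow> nat \<Rightarrow> (nat \<Rightarrow> nat) scaled" where
  "shape_step g h i =
    (if removable g i h then Some (1, h) else if addable i h then Some (0, add_box i h) else None)"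

lemma shape_step_le: "g \<le> h \<Longrightarrow> shape_step g h i = Some (d, k) \<Longrightarrow> g \<le> k"
  by (auto simp: shape_step_def le_fun_def le_SucI split: if_splits)

lemma shape_step_eq_Some_iff:
  assumes "g \<le> h"
  shows "shape_step g h i = Some (d, k) \<longleftrightarrow>
    removable g i k \<and> (d = 1 \<and> h = k \<or> d = 0 \<and> h = remove_box i k)"
  (is "_ \<longleftrightarrow> ?reached")
proof
  assume "shape_step g h i = Some (d, k)"
  then consider (loop) "d = 1" "k = h" "removable g i h"
    | (add) "d = 0" "k = add_box i h" "addable i h"
    by (auto simp: shape_step_def split: if_splits)
  then show ?reached
    by cases (use removable_add_box[OF _ assms] in auto)
next
  assume ?reached
  then show "shape_step g h i = Some (d, k)"
  proof (elim conjE disjE)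
    assume removable: "removable g i k" and smaller: "d = 0" "h = remove_box i k"
    show ?thesis
      using addable_remove_box[OF removable] addable_not_removable add_remove_box[OF removable]
      by (simp add: shape_step_def smaller)
  qed (simp add: shape_step_def)
qed

lemma act_shape_Cons_eq_None:
  assumes "g \<le> h" "\<And>k. removable g i k \<Longrightarrow> act (shape_step g) k a = None"
  shows "act (shape_step g) h (i # a) = None"
proof (cases "shape_step g h i")
  case (Some p)
  obtain d k where p_eq: "p = (d, k)" by fastforce
  then have "removable g i k"
    using Some shape_step_eq_Some_iff[OF assms(1)] by blast
  then show ?thesis using assms(2) by (simp add: Some p_eq)
qed simp

lemma shape_braid3_eq_None:
  assumes "g \<le> h" "0 < i"
  shows "act (shape_step g) h [i, Suc i, i] = None" "act (shape_step g) h [Suc i, i, Suc i] = None"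
  using assms(2)
  by (intro act_shape_Cons_eq_None[OF assms(1)];
      auto simp: shape_step_def removable_def addable_def)+

lemma shape_braid4_eq_None:
  assumes "g \<le> h"
  shows "act (shape_step g) h [1, 0, 1, 0] = None" "act (shape_step g) h [0, 1, 0, 1] = None"
  by (intro act_shape_Cons_eq_None[OF assms]; auto simp: shape_step_def removable_def addable_def)+

lemma shape_quadratic:
  assumes "g \<le> h"
  shows "act (shape_step g) h [i, i] = beta_shift 1 (act (shape_step g) h [i])"
  using removable_add_box[OF _ assms] by (simp add: shape_step_def)

lemma shape_commute:
  assumes "\<bar>int i - int j\<bar> > 1"
  shows "act (shape_step g) h [i, j] = act (shape_step g) h [j, i]"
proof -
  have far: "\<bar>int j - int i\<bar> > 1" "i \<noteq> j" using assms by auto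
  then have "add_box j (add_box i h) = add_box i (add_box j h)"
    by (simp add: fun_upd_twist)
  then show ?thesis
    using far assms by (simp add: shape_step_def removable_fun_upd addable_fun_upd)
qed

locale inner_shape =
  fixes n :: nat and g :: "nat \<Rightarrow> nat"
  assumes staircase_inner: "staircase n g"

sublocale inner_shape \<subseteq> hecke_module n "{h. staircase n h \<and> g \<le> h}" "shape_step g"
proof
  fix h k i d
  assume shape: "h \<in> {h. staircase n h \<and> g \<le> h}" and "i < n"
    and step: "shape_step g h i = Some (d, k)"
  moreover from shape step have "g \<le> k"
    using shape_step_le by blast
  ultimately show "k \<in> {h. staircase n h \<and> g \<le> h}"
    using staircase_add_box by (auto simp: shape_step_def split: if_splits)
next
  fix h r s d
  assume "h \<in> {h. staircase n h \<and> g \<le> h}" and relation: "hecke_relation n r s d"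
  then have contains: "g \<le> h" by simp
  from relation show "act (shape_step g) h r = beta_shift d (act (shape_step g) h s)"
  proof cases
    case (quadratic i)
    then show ?thesis using shape_quadratic[OF contains] by simp
  next
    case braid4
    then show ?thesis using shape_braid4_eq_None[OF contains] by simp
  next
    case (braid3 i)
    then show ?thesis using shape_braid3_eq_None[OF contains, of i] by simp
  next
    case (commute i j)
    then show ?thesis using shape_commute[of i j g h] by simp
  qed
qed

lemma act_shape_le:
  "act (shape_step g) g a = Some (d, h) \<Longrightarrow> g \<le> h"
proof (induction a arbitrary: d h rule: rev_induct)
  case (snoc i a)
  then show ?case unfolding act_snoc_eq_Some_iff using shape_step_le by blast
qed simp

definition growth_word :: "(nat \<Rightarrow> nat) \<Rightarrow> (nat \<Rightarrow> nat) \<Rightarrow> nat list \<Rightarrow> bool" where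
  "growth_word g h a \<longleftrightarrow> act (shape_step g) g a = Some (0, h)"

lemma growth_word_le: "growth_word g h a \<Longrightarrow> g \<le> h"
  unfolding growth_word_def by (rule act_shape_le)

lemma growth_word_Nil_iff: "growth_word g h [] \<longleftrightarrow> h = g"
  by (auto simp: growth_word_def)

lemma growth_word_snoc_iff:
  "growth_word g h (a @ [i]) \<longleftrightarrow> removable g i h \<and> growth_word g (remove_box i h) a"
proof
  assume "growth_word g h (a @ [i])"
  then obtain k where split: "growth_word g k a" "shape_step g k i = Some (0, h)"
    by (auto simp: growth_word_def act_snoc_eq_Some_iff)
  then show "removable g i h \<and> growth_word g (remove_box i h) a"
    using shape_step_eq_Some_iff[OF growth_word_le[OF split(1)]] by auto
next
  assume removable: "removable g i h \<and> growth_word g (remove_box i h) a"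
  then have "shape_step g (remove_box i h) i = Some (0, h)"
    using shape_step_eq_Some_iff[OF growth_word_le] by blast
  with removable show "growth_word g h (a @ [i])"
    unfolding growth_word_def act_snoc_eq_Some_iff by force
qed

lemma growth_word_letters:
  "growth_word g h a \<Longrightarrow> staircase n h \<Longrightarrow> set a \<subseteq> {..<n}"
proof (induction a arbitrary: h rule: rev_induct)
  case (snoc i a)
  then have "removable g i h" "growth_word g (remove_box i h) a"
    by (simp_all add: growth_word_snoc_iff)
  then show ?case
    using snoc.IH staircase_remove_box[OF snoc.prems(2)] removable_less[OF _ snoc.prems(2)] by auto
qed simp

text \<open>The box can be added last because every letter after it commutes with it.\<close>

lemma growth_word_move_last:
  "growth_word g h b \<Longrightarrow> removable g i h \<Longrightarrow>
    \<exists>c. growth_word g (remove_box i h) c \<and> word_perm (c @ [i]) = word_perm b \<and>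
      Suc (length c) = length b"
proof (induction b arbitrary: h rule: rev_induct)
  case Nil
  then show ?case by (simp add: growth_word_Nil_iff removable_def)
next
  case (snoc j b)
  have last_box: "removable g j h" "growth_word g (remove_box j h) b"
    using snoc.prems(1) by (simp_all add: growth_word_snoc_iff)
  show ?case
  proof (cases "i = j")
    case True
    with last_box(2) show ?thesis by (metis length_append_singleton)
  next
    case False
    have far: "\<bar>int i - int j\<bar> > 1" "\<bar>int j - int i\<bar> > 1"
      using removable_not_neighbours[OF snoc.prems(2) last_box(1) False] by simp_all
    have "removable g i (remove_box j h)"
      using snoc.prems(2) far by (simp only: removable_fun_upd)
    then obtain c where moved: "growth_word g (remove_box i (remove_box j h)) c"
      "word_perm (c @ [i]) = word_perm b" "Suc (length c) = length b"
      using snoc.IH[OF last_box(2)] by blast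
    have "remove_box i (remove_box j h) = remove_box j (remove_box i h)"
      using False by (simp add: fun_upd_twist)
    then have "growth_word g (remove_box i h) (c @ [j])"
      using moved(1) last_box(1) far by (simp add: growth_word_snoc_iff removable_fun_upd)
    moreover have "word_perm ((c @ [j]) @ [i]) = word_perm (b @ [j])"
    proof -
      have "word_perm ((c @ [j]) @ [i]) = word_perm c \<circ> (cox_gen j \<circ> cox_gen i)"
        by (simp only: word_perm_snoc comp_assoc)
      also have "\<dots> = word_perm (c @ [i]) \<circ> cox_gen j"
        unfolding cox_gen_commute[OF far(2)] by (simp only: word_perm_snoc comp_assoc)
      finally show ?thesis using moved(2) by (simp only: word_perm_snoc)
    qed
    ultimately show ?thesis
      using moved(3) by (metis length_append_singleton)
  qed
qed

lemma growth_word_perm_unique: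
  "growth_word g h a \<Longrightarrow> growth_word g h b \<Longrightarrow> word_perm a = word_perm b"
proof (induction a arbitrary: h b rule: rev_induct)
  case Nil
  then have "b = []"
    by (cases b rule: rev_cases) (auto simp: growth_word_Nil_iff growth_word_snoc_iff removable_def)
  then show ?case by simp
next
  case (snoc i a)
  then have last_box: "removable g i h" "growth_word g (remove_box i h) a"
    by (simp_all add: growth_word_snoc_iff)
  obtain c where moved: "growth_word g (remove_box i h) c" "word_perm (c @ [i]) = word_perm b"
    using growth_word_move_last[OF snoc.prems(2) last_box(1)] by blast
  from snoc.IH[OF last_box(2) moved(1)] moved(2) show ?case
    by (simp only: word_perm_snoc)
qed

context inner_shape
begin

lemma inner_in_shapes: "g \<in> {h. staircase n h \<and> g \<le> h}"
  by (simp add: staircase_inner)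

lemma growth_word_u_equiv:
  "growth_word g h a \<Longrightarrow> u_equiv n (u_word a) (u_word b) \<Longrightarrow> growth_word g h b"
  unfolding growth_word_def by (rule act_u_equiv[OF inner_in_shapes])

lemma growth_word_imp_ascending_word:
  "growth_word g h a \<Longrightarrow> staircase n h \<Longrightarrow> ascending_word n (word_perm a) a"
proof (induction a arbitrary: h rule: rev_induct)
  case Nil
  show ?case by (simp only: ascending_word_Nil_iff word_perm_Nil)
next
  case (snoc i a)
  then have last_box: "removable g i h" "growth_word g (remove_box i h) a"
    by (simp_all add: growth_word_snoc_iff)
  then have prefix: "ascending_word n (word_perm a) a"
    using snoc.IH staircase_remove_box[OF snoc.prems(2)] by blast
  have "i < n"
    using last_box(1) snoc.prems(2) by (rule removable_less)
  have "\<not> descent i (word_perm a)"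
  proof
    assume descent: "descent i (word_perm a)"
    obtain c where "ascending_word n (word_perm a \<circ> cox_gen i) c"
      using exists_ascending_word
        comp_cox_gen_signed_perms[OF ascending_word_signed_perms[OF prefix] \<open>i < n\<close>]
      by blast
    then have "ascending_word n (word_perm a) (c @ [i])"
      using descent \<open>i < n\<close> by (simp add: ascending_word_snoc_iff)
    then have "growth_word g (remove_box i h) (c @ [i])"
      using growth_word_u_equiv[OF last_box(2)] ascending_words_equiv[OF prefix] by blast
    then show False
      using addable_not_removable[OF addable_remove_box[OF last_box(1)]]
      by (simp add: growth_word_snoc_iff)
  qed
  then show ?case
    unfolding word_perm_snoc by (rule ascending_word_snoc[OF prefix \<open>i < n\<close>])
qed

lemma ascending_word_imp_growth_word:
  "ascending_word n w a \<Longrightarrow> act (shape_step g) g a = Some (k, h) \<Longrightarrow> growth_word g h a"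
proof (induction a arbitrary: w k h rule: rev_induct)
  case Nil
  then show ?case by (simp add: growth_word_Nil_iff)
next
  case (snoc i a)
  have prefix: "ascending_word n (w \<circ> cox_gen i) a"
    using snoc.prems(1) by (simp add: ascending_word_snoc_iff)
  obtain d e l where act_a: "act (shape_step g) g a = Some (d, l)"
    and step: "shape_step g l i = Some (e, h)"
    using snoc.prems(2) unfolding act_snoc_eq_Some_iff by blast
  have growth: "growth_word g l a"
    using snoc.IH[OF prefix act_a] .
  have "staircase n l"
    using act_closed[OF inner_in_shapes _ act_a] prefix by (simp add: ascending_word_def)
  have "\<not> removable g i l"
  proof
    assume "removable g i l"
    then obtain c where moved: "growth_word g (remove_box i l) c"
      "word_perm (c @ [i]) = word_perm a"
      "Suc (length c) = length a"
      using growth_word_move_last[OF growth] by blast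
    have "word_perm c = word_perm a \<circ> cox_gen i"
      unfolding moved(2)[symmetric] by (simp only: word_perm_snoc comp_cox_gen_cancel)
    also have "\<dots> = w"
      unfolding word_perm_ascending_word[OF prefix] by (rule comp_cox_gen_cancel)
    finally have "length (a @ [i]) \<le> length c"
      using ascending_word_length_le[OF snoc.prems(1)] growth_word_letters[OF moved(1)]
        staircase_remove_box[OF \<open>staircase n l\<close> \<open>removable g i l\<close>] by blast
    with moved(3) show False by simp
  qed
  then have "shape_step g l i = Some (0, h)"
    using step by (auto simp: shape_step_def split: if_splits)
  with growth show ?case
    unfolding growth_word_def act_snoc_eq_Some_iff by force
qed

lemma act_coeff_shape_dual:
  assumes growth: "growth_word g h b" and outer: "staircase n h"
    and ascending: "ascending_word n w a"
  shows "act_coeff (shape_step g) g h (UWord a) = of_bool (w = word_perm b)"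
proof (cases "growth_word g h a")
  case True
  then have "w = word_perm b"
    using growth_word_perm_unique[OF growth] word_perm_ascending_word[OF ascending] by simp
  with True show ?thesis
    by (simp add: act_coeff_def growth_word_def)
next
  case False
  then have "act (shape_step g) g a \<noteq> Some (k, h)" for k
    using ascending_word_imp_growth_word[OF ascending] by blast
  then have "act_coeff (shape_step g) g h (UWord a) = 0"
    by (auto simp: act_coeff_def split: option.split)
  moreover have "w \<noteq> word_perm b"
    using False growth_word_u_equiv[OF growth]
      ascending_words_equiv[OF growth_word_imp_ascending_word[OF growth outer]] ascending
    by blast
  ultimately show ?thesis by simp
qed

lemma u_coeffs_eq_lin_ext_shape:
  assumes growth: "growth_word g h b" and outer: "staircase n h" and free: "f \<in> free_ualg n"
  shows "u_coeffs n f (word_perm b) = lin_ext (act_coeff (shape_step g) g h) f"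
proof (rule expansion_coeff_eq[OF inner_in_shapes, where c = "u_coeffs n f"])
  show "word_perm b \<in> signed_perms n"
    using ascending_word_signed_perms[OF growth_word_imp_ascending_word[OF growth outer]] .
  show "expansion n f (u_coeffs n f)"
    using free by (rule expansion_u_coeffs)
qed (rule act_coeff_shape_dual[OF growth outer])

end

lemma act_coeff_shape_snoc:
  "act_coeff (shape_step g) g h (u + UWord [i]) =
    (if removable g i h
     then xbeta * act_coeff (shape_step g) g h u + act_coeff (shape_step g) g (remove_box i h) u
     else 0)"
proof (cases "act (shape_step g) g (letters u)")
  case None
  then show ?thesis by (simp add: act_coeff_def act_append plus_uword_def)
next
  case (Some p)
  obtain k l where p_eq: "p = (k, l)" by fastforce
  note act_u = Some[unfolded p_eq]
  note step_iff = shape_step_eq_Some_iff[OF act_shape_le[OF act_u]]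
  have coeff: "act_coeff (shape_step g) g m u = (if l = m then xbeta ^ k else 0)" for m
    by (simp add: act_coeff_def act_u)
  show ?thesis
  proof (cases "\<exists>d. shape_step g l i = Some (d, h)")
    case True
    then obtain d where step: "shape_step g l i = Some (d, h)" by blast
    then have "act_coeff (shape_step g) g h (u + UWord [i]) = xbeta ^ (k + d)"
      by (simp add: act_coeff_def act_append act_u plus_uword_def)
    moreover have "removable g i h" "d = 1 \<and> l = h \<or> d = 0 \<and> l = remove_box i h"
      using step by (simp_all add: step_iff)
    ultimately show ?thesis
      using remove_box_neq[of g i h] by (auto simp: coeff)
  next
    case False
    then have "act_coeff (shape_step g) g h (u + UWord [i]) = 0"
      by (auto simp: act_coeff_def act_append act_u plus_uword_def split: option.split)
    with False show ?thesis by (auto simp: coeff step_iff)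
  qed
qed

section \<open>Cells and corners\<close>

definition diag_index :: "nat \<times> nat \<Rightarrow> nat" where
  "diag_index c = snd c - fst c"

definition adjacent :: "nat \<times> nat \<Rightarrow> nat \<times> nat \<Rightarrow> bool" where
  "adjacent c d \<longleftrightarrow> d = (fst c + 1, snd c) \<or> d = (fst c, snd c + 1)"

definition corners :: "nat \<Rightarrow> (nat \<times> nat) set \<Rightarrow> (nat \<times> nat) set" where
  "corners i C = {c \<in> C. diag_index c = i \<and> (\<forall>d\<in>C. \<not> adjacent c d)}"

definition cells :: "(nat \<Rightarrow> nat) \<Rightarrow> (nat \<Rightarrow> nat) \<Rightarrow> (nat \<times> nat) set" where
  "cells g h = {(r, c). r \<le> c \<and> g (c - r) < r \<and> r \<le> h (c - r)}"

lemma cells_iff: "(r, r + i) \<in> cells g h \<longleftrightarrow> g i < r \<and> r \<le> h i"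
  by (simp add: cells_def)

lemma cellsE:
  assumes "c \<in> cells g h"
  obtains r where "c = (r, r + diag_index c)" "g (diag_index c) < r" "r \<le> h (diag_index c)"
proof -
  obtain r k where "c = (r, k)" by fastforce
  with assms that[of r] show thesis
    by (simp add: cells_def diag_index_def)
qed

lemma cells_diag_index_less:
  assumes "staircase n h" "c \<in> cells g h"
  shows "diag_index c < n"
  using assms(2) by (rule cellsE) (use staircase_eq_0[OF assms(1), of "diag_index c"] in force)

lemma finite_cells:
  assumes outer: "staircase n h"
  shows "finite (cells g h)"
proof (rule finite_subset)
  show "cells g h \<subseteq> (\<lambda>(r, i). (r, r + i)) ` ({..h 0} \<times> {..<n})"
  proof
    fix c
    assume cell: "c \<in> cells g h"
    then obtain r where row: "c = (r, r + diag_index c)" "r \<le> h (diag_index c)"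
      by (rule cellsE)
    then have "r \<le> h 0"
      using antimonoD[OF staircase_antimono[OF outer], of 0 "diag_index c"] by simp
    then show "c \<in> (\<lambda>(r, i). (r, r + i)) ` ({..h 0} \<times> {..<n})"
      using row(1) cells_diag_index_less[OF outer cell]
      by (intro image_eqI[of _ _ "(r, diag_index c)"]) simp_all
  qed
qed simp

lemma cells_eq_empty_iff:
  assumes "g \<le> h"
  shows "cells g h = {} \<longleftrightarrow> h = g"
proof
  assume empty: "cells g h = {}"
  show "h = g"
  proof
    fix i
    have "(h i, h i + i) \<notin> cells g h" using empty by simp
    then show "h i = g i"
      using le_funD[OF assms, of i] by (simp add: cells_iff)
  qed
qed (auto simp: cells_def)

lemma removable_corner:
  assumes removable: "removable g i h"
  shows "(h i, h i + i) \<in> corners i (cells g h)"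
proof -
  have "\<not> adjacent (h i, h i + i) d" if cell: "d \<in> cells g h" for d
  proof
    assume "adjacent (h i, h i + i) d"
    then consider (right) "d = (h i, h i + Suc i)" | (below) "d = (Suc (h i), h i + i)"
      by (auto simp: adjacent_def)
    then show False
    proof cases
      case right
      with cell removable show False by (simp only: cells_iff removable_def) simp
    next
      case below
      show False
      proof (cases i)
        case 0
        with cell below show False by (simp add: cells_def)
      next
        case (Suc j)
        with below have "d = (Suc (h i), Suc (h i) + j)" by simp
        with cell have "Suc (h i) \<le> h j" by (simp only: cells_iff)
        with removable Suc show False by (simp add: removable_def)
      qed
    qed
  qed
  moreover have "(h i, h i + i) \<in> cells g h"
    using removable by (simp only: cells_iff removable_def) simp
  ultimately show ?thesis
    by (simp add: corners_def diag_index_def)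
qed

lemma corner_removable:
  assumes inner: "staircase n g" and outer: "staircase n h" and corner: "c \<in> corners i (cells g h)"
  shows "removable g i h" "c = (h i, h i + i)"
proof -
  obtain r where row: "c = (r, r + i)" "g i < r" "r \<le> h i"
    using corner by (auto simp: corners_def elim: cellsE)
  have no_successor: "d \<notin> cells g h" if "adjacent c d" for d
    using corner that by (auto simp: corners_def)
  have "(r, r + Suc i) \<notin> cells g h"
    by (rule no_successor) (simp add: row adjacent_def)
  then have last: "r = h i" "h i = Suc (h (Suc i))"
    using row(2,3) staircase_Suc_le[OF inner, of i] staircase_le_Suc[OF outer, of i]
    unfolding cells_iff by linarith+
  then show "c = (h i, h i + i)" using row(1) by simp
  have "h j = h i" if i_eq: "i = Suc j" for j
  proof -
    have "(Suc r, Suc r + j) \<notin> cells g h"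
      by (rule no_successor) (simp add: row adjacent_def i_eq)
    then show ?thesis
      using row(2) last(1) staircase_le_Suc[OF inner, of j] staircase_Suc_le[OF outer, of j] i_eq
      unfolding cells_iff by simp
  qed
  then have "i = 0 \<or> h (i - 1) = h i"
    by (cases i) simp_all
  with row(2) last show "removable g i h"
    by (simp add: removable_def)
qed

lemma corners_cells:
  assumes "staircase n g" "staircase n h"
  shows "corners i (cells g h) = (if removable g i h then {(h i, h i + i)} else {})"
proof -
  have "corners i (cells g h) \<subseteq> {(h i, h i + i)}"
    using corner_removable(2)[OF assms] by blast
  then show ?thesis
    using removable_corner[of g i h] corner_removable(1)[OF assms]
    by (cases "removable g i h") fastforce+
qed

lemma cells_remove_box:
  assumes removable: "removable g i h"
  shows "cells g (remove_box i h) = cells g h - {(h i, h i + i)}"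
proof (rule set_eqI)
  fix c :: "nat \<times> nat"
  obtain r k where c_eq: "c = (r, k)" by fastforce
  show "c \<in> cells g (remove_box i h) \<longleftrightarrow> c \<in> cells g h - {(h i, h i + i)}"
  proof (cases "r \<le> k \<and> k - r = i")
    case True
    then have k_eq: "k = r + i" by linarith
    show ?thesis
      unfolding c_eq k_eq using removable by (auto simp: cells_iff removable_def)
  next
    case False
    then show ?thesis
      unfolding c_eq by (auto simp: cells_def)
  qed
qed

lemma exists_removable:
  assumes inner: "staircase n g" and outer: "staircase n h" and "g \<le> h" "h \<noteq> g"
  shows "\<exists>i. removable g i h"
proof -
  let ?rank = "\<lambda>c :: nat \<times> nat. fst c + snd c"
  have "Max (?rank ` cells g h) \<in> ?rank ` cells g h"
    using assms(3,4)
    by (intro Max_in finite_imageI finite_cells[OF outer]) (simp add: cells_eq_empty_iff)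
  then obtain c where greatest: "c \<in> cells g h" "Max (?rank ` cells g h) = ?rank c" by auto
  have "\<not> adjacent c d" if "d \<in> cells g h" for d
  proof
    assume "adjacent c d"
    then have "?rank d = Suc (?rank c)" by (auto simp: adjacent_def)
    moreover have "?rank d \<le> ?rank c"
      using that finite_cells[OF outer] unfolding greatest(2)[symmetric] by (intro Max_ge) auto
    ultimately show False by simp
  qed
  then have "c \<in> corners (diag_index c) (cells g h)"
    using greatest(1) by (simp add: corners_def)
  then show ?thesis
    using corner_removable(1)[OF inner outer] by blast
qed

lemma exists_growth_word:
  assumes inner: "staircase n g"
  shows "staircase n h \<Longrightarrow> g \<le> h \<Longrightarrow> \<exists>a. growth_word g h a"
proof (induction "card (cells g h)" arbitrary: h rule: less_induct)
  case less
  show ?case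
  proof (cases "h = g")
    case True
    then show ?thesis using growth_word_Nil_iff by blast
  next
    case False
    then obtain i where removable: "removable g i h"
      using exists_removable[OF inner less.prems] by blast
    have "(h i, h i + i) \<in> cells g h"
      using removable_corner[OF removable] by (simp add: corners_def)
    then have "card (cells g (remove_box i h)) < card (cells g h)"
      unfolding cells_remove_box[OF removable]
      by (intro card_Diff1_less finite_cells[OF less.prems(1)])
    then obtain a where "growth_word g (remove_box i h) a"
      using less.hyps staircase_remove_box[OF less.prems(1) removable]
        le_remove_box[OF less.prems(2) removable]
      by blast
    with removable have "growth_word g h (a @ [i])"
      by (simp add: growth_word_snoc_iff)
    then show ?thesis by blast
  qed
qed

section \<open>Tableaux over an ordered list of factors\<close>

text \<open>The order in which the factors \<open>1 + x\<^sub>k u\<^sub>i\<close> occur: the pair \<open>(-k, i)\<close> stands for the factor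
  in the decreasing half of the \<open>k\<close>-th block, and \<open>(k, i)\<close> for the one in the increasing half.\<close>

definition before :: "int \<times> nat \<Rightarrow> int \<times> nat \<Rightarrow> bool" where
  "before p q \<longleftrightarrow> prec (fst p) (fst q) \<or>
    fst p = fst q \<and> (if fst p < 0 then snd q < snd p else snd p < snd q)"

lemma prec_asym: "prec a b \<Longrightarrow> \<not> prec b a"
  unfolding prec_def by linarith

lemma before_asym: "before p q \<Longrightarrow> \<not> before q p"
  unfolding before_def using prec_asym by (metis less_asym)

lemma before_irrefl: "\<not> before p p"
  by (simp add: before_def prec_def)

definition filled :: "(nat \<times> nat \<Rightarrow> int set) \<Rightarrow> (nat \<times> nat) set" where
  "filled T = {c. T c \<noteq> {}}"

definition factor_tableaux :: "(int \<times> nat) list \<Rightarrow> (nat \<times> nat) set \<Rightarrow> (nat \<times> nat \<Rightarrow> int set) set" where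
  "factor_tableaux ps C = {T. filled T = C \<and>
     (\<forall>c. \<forall>v\<in>T c. (v, diag_index c) \<in> set ps) \<and>
     (\<forall>c d. adjacent c d \<longrightarrow> (\<forall>v\<in>T c. \<forall>v'\<in>T d. before (v, diag_index c) (v', diag_index d)))}"

lemma factor_tableauxI:
  assumes "filled T = C" "\<And>c v. v \<in> T c \<Longrightarrow> (v, diag_index c) \<in> set ps"
    and "\<And>c d v v'. adjacent c d \<Longrightarrow> v \<in> T c \<Longrightarrow> v' \<in> T d \<Longrightarrow> before (v, diag_index c) (v', diag_index d)"
  shows "T \<in> factor_tableaux ps C"
  unfolding factor_tableaux_def using assms by blast

lemma factor_tableaux_filled: "T \<in> factor_tableaux ps C \<Longrightarrow> filled T = C"
  and factor_tableaux_entry: "T \<in> factor_tableaux ps C \<Longrightarrow> v \<in> T c \<Longrightarrow> (v, diag_index c) \<in> set ps"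
  and factor_tableaux_before: "T \<in> factor_tableaux ps C \<Longrightarrow> adjacent c d \<Longrightarrow> v \<in> T c \<Longrightarrow> v' \<in> T d \<Longrightarrow>
    before (v, diag_index c) (v', diag_index d)"
  unfolding factor_tableaux_def by blast+

lemma factor_tableaux_subset:
  assumes "T \<in> factor_tableaux ps C"
  shows "T c \<subseteq> fst ` set ps"
proof
  fix v
  assume "v \<in> T c"
  from factor_tableaux_entry[OF assms this] show "v \<in> fst ` set ps"
    by (rule rev_image_eqI) simp
qed

lemma factor_tableaux_finite_entry: "T \<in> factor_tableaux ps C \<Longrightarrow> finite (T c)"
  by (rule finite_subset[OF factor_tableaux_subset]) simp_all

lemma finite_factor_tableaux:
  assumes "finite C"
  shows "finite (factor_tableaux ps C)"
proof (rule finite_subset)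
  let ?fillings = "{T. \<forall>c. (c \<in> C \<longrightarrow> T c \<in> Pow (fst ` set ps)) \<and> (c \<notin> C \<longrightarrow> T c = {})}"
  show "factor_tableaux ps C \<subseteq> ?fillings"
  proof (intro subsetI CollectI allI conjI impI)
    fix T c
    assume tableau: "T \<in> factor_tableaux ps C"
    show "T c \<in> Pow (fst ` set ps)"
      using factor_tableaux_subset[OF tableau] by simp
    show "T c = {}" if "c \<notin> C"
      using that factor_tableaux_filled[OF tableau] by (auto simp: filled_def)
  qed
  show "finite ?fillings"
    using assms by (intro finite_set_of_finite_funs) auto
qed

definition cell_weight :: "int set \<Rightarrow> xpoly" where
  "cell_weight A = xbeta ^ (card A - 1) * (\<Prod>s\<in>A. xvar (nat \<bar>s\<bar>))"

definition tableau_sum :: "(int \<times> nat) list \<Rightarrow> (nat \<times> nat) set \<Rightarrow> xpoly" where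
  "tableau_sum ps C = (\<Sum>T\<in>factor_tableaux ps C. \<Prod>c\<in>C. cell_weight (T c))"

lemma cell_weight_empty [simp]: "cell_weight {} = 1"
  by (simp add: cell_weight_def)

lemma cell_weight_insert:
  assumes "finite A" "v \<notin> A"
  shows "cell_weight (insert v A) = xvar (nat \<bar>v\<bar>) * (if A = {} then 1 else xbeta) * cell_weight A"
proof (cases "A = {}")
  case False
  then obtain k where "card A = Suc k"
    using assms(1) by (metis card_eq_0_iff not0_implies_Suc)
  with assms False show ?thesis by (simp add: cell_weight_def algebra_simps)
qed (simp add: cell_weight_def)

lemma tableau_sum_Nil: "tableau_sum [] C = (if C = {} then 1 else 0)"
proof -
  have "factor_tableaux [] C = (if C = {} then {\<lambda>_. {}} else {})"
    by (auto simp: factor_tableaux_def filled_def fun_eq_iff)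
  then show ?thesis by (simp add: tableau_sum_def)
qed

lemma factor_tableaux_mono: "set ps \<subseteq> set qs \<Longrightarrow> factor_tableaux ps C \<subseteq> factor_tableaux qs C"
  unfolding factor_tableaux_def by blast

lemma last_entry_in_corner:
  assumes tableau: "T \<in> factor_tableaux (ps @ [(v, i)]) C"
    and last: "\<And>q. q \<in> set ps \<Longrightarrow> before q (v, i)"
    and entry: "v \<in> T c" "diag_index c = i"
  shows "c \<in> corners i C"
proof -
  have "\<not> adjacent c d" if "d \<in> C" for d
  proof
    assume adjacent: "adjacent c d"
    obtain v' where neighbour: "v' \<in> T d"
      using \<open>d \<in> C\<close> factor_tableaux_filled[OF tableau] by (auto simp: filled_def)
    then have "before (v, i) (v', diag_index d)"
      using factor_tableaux_before[OF tableau adjacent entry(1)] entry(2) by simp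
    moreover have "(v', diag_index d) \<in> set ps \<or> (v', diag_index d) = (v, i)"
      using factor_tableaux_entry[OF tableau neighbour] by auto
    ultimately show False
      using last before_asym before_irrefl by metis
  qed
  moreover have "c \<in> C"
    using entry(1) factor_tableaux_filled[OF tableau] by (auto simp: filled_def)
  ultimately show ?thesis
    using entry(2) by (simp add: corners_def)
qed

lemma tableau_sum_snoc_no_corner:
  assumes last: "\<And>q. q \<in> set ps \<Longrightarrow> before q (v, i)" and "corners i C = {}"
  shows "tableau_sum (ps @ [(v, i)]) C = tableau_sum ps C"
proof -
  have "factor_tableaux (ps @ [(v, i)]) C \<subseteq> factor_tableaux ps C"
  proof
    fix T
    assume tableau: "T \<in> factor_tableaux (ps @ [(v, i)]) C"
    have "(x, diag_index c) \<in> set ps" if "x \<in> T c" for c x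
      using factor_tableaux_entry[OF tableau that] last_entry_in_corner[OF tableau last, of c]
        that assms(2)
      by auto
    then show "T \<in> factor_tableaux ps C"
      using factor_tableaux_filled[OF tableau] factor_tableaux_before[OF tableau]
      by (intro factor_tableauxI)
  qed
  then have "factor_tableaux (ps @ [(v, i)]) C = factor_tableaux ps C"
    using factor_tableaux_mono[of ps "ps @ [(v, i)]" C] by auto
  then show ?thesis by (simp add: tableau_sum_def)
qed

context
  fixes ps :: "(int \<times> nat) list" and v :: int and i :: nat and C :: "(nat \<times> nat) set"
    and c0 :: "nat \<times> nat"
  assumes last: "\<And>q. q \<in> set ps \<Longrightarrow> before q (v, i)"
    and corner: "corners i C = {c0}"
begin

lemma corner_cell: "c0 \<in> C" "diag_index c0 = i" "d \<in> C \<Longrightarrow> \<not> adjacent c0 d"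
  using corner by (auto simp: corners_def)

lemma last_entry_new: "T \<in> factor_tableaux ps D \<Longrightarrow> v \<notin> T c0"
  using factor_tableaux_entry[of T ps D v c0] last before_irrefl corner_cell(2) by blast

lemma insert_last_entry:
  assumes tableau: "T \<in> factor_tableaux ps D" and cells: "insert c0 D = C"
  shows "T(c0 := insert v (T c0)) \<in> factor_tableaux (ps @ [(v, i)]) C"
proof (rule factor_tableauxI)
  let ?T = "T(c0 := insert v (T c0))"
  show filled: "filled ?T = C"
    using factor_tableaux_filled[OF tableau] cells by (auto simp: filled_def)
  fix c x
  assume entry_c: "x \<in> ?T c"
  then show "(x, diag_index c) \<in> set (ps @ [(v, i)])"
    using factor_tableaux_entry[OF tableau, of x c] corner_cell(2) by (auto split: if_splits)
  fix d y
  assume adjacent: "adjacent c d" and entry_d: "y \<in> ?T d"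
  then have "d \<in> C"
    using filled by (auto simp: filled_def)
  then have "c \<noteq> c0"
    using adjacent corner_cell(3) by blast
  with entry_c have entry_T: "x \<in> T c" by simp
  show "before (x, diag_index c) (y, diag_index d)"
  proof (cases "y \<in> T d")
    case True
    with entry_T show ?thesis by (rule factor_tableaux_before[OF tableau adjacent])
  next
    case False
    with entry_d have "y = v" "d = c0" by (auto split: if_splits)
    then show ?thesis
      using last[OF factor_tableaux_entry[OF tableau entry_T]] corner_cell(2) by simp
  qed
qed

lemma remove_last_entry:
  assumes tableau: "T \<in> factor_tableaux (ps @ [(v, i)]) C"
  shows "T(c0 := T c0 - {v}) \<in> factor_tableaux ps (if T c0 = {v} then C - {c0} else C)"
proof (rule factor_tableauxI)
  let ?T = "T(c0 := T c0 - {v})"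
  have "T c0 \<noteq> {}"
    using corner_cell(1) factor_tableaux_filled[OF tableau] by (auto simp: filled_def)
  then show "filled ?T = (if T c0 = {v} then C - {c0} else C)"
    using factor_tableaux_filled[OF tableau] by (auto simp: filled_def)
  fix c x
  assume entry: "x \<in> ?T c"
  have subset: "?T d \<subseteq> T d" for d by auto
  have "\<not> (x = v \<and> diag_index c = i)"
    using last_entry_in_corner[OF tableau last, of c] entry corner by (auto split: if_splits)
  then show "(x, diag_index c) \<in> set ps"
    using factor_tableaux_entry[OF tableau subsetD[OF subset entry]] by auto
  fix d y
  assume "adjacent c d" "y \<in> ?T d"
  with entry show "before (x, diag_index c) (y, diag_index d)"
    using factor_tableaux_before[OF tableau] subset by blast
qed

lemma factor_tableaux_without_last_entry:
  "{T \<in> factor_tableaux (ps @ [(v, i)]) C. v \<notin> T c0} = factor_tableaux ps C"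
proof
  show "{T \<in> factor_tableaux (ps @ [(v, i)]) C. v \<notin> T c0} \<subseteq> factor_tableaux ps C"
  proof
    fix T
    assume "T \<in> {T \<in> factor_tableaux (ps @ [(v, i)]) C. v \<notin> T c0}"
    then have tableau: "T \<in> factor_tableaux (ps @ [(v, i)]) C" and "v \<notin> T c0" by simp_all
    then have "T c0 \<noteq> {v}" "T(c0 := T c0 - {v}) = T" by auto
    with remove_last_entry[OF tableau] show "T \<in> factor_tableaux ps C" by simp
  qed
  show "factor_tableaux ps C \<subseteq> {T \<in> factor_tableaux (ps @ [(v, i)]) C. v \<notin> T c0}"
    using factor_tableaux_mono[of ps "ps @ [(v, i)]" C] last_entry_new by auto
qed

lemma prod_cell_weight_insert_last_entry:
  assumes tableau: "T \<in> factor_tableaux ps D" and "finite C"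
  shows "(\<Prod>c\<in>C. cell_weight ((T(c0 := insert v (T c0))) c)) =
    xvar (nat \<bar>v\<bar>) * (if c0 \<in> D then xbeta else 1) * (\<Prod>c\<in>C. cell_weight (T c))"
proof -
  have "(\<Prod>c\<in>C. cell_weight ((T(c0 := insert v (T c0))) c)) =
      cell_weight (insert v (T c0)) * (\<Prod>c\<in>C - {c0}. cell_weight (T c))"
    using corner_cell(1) \<open>finite C\<close> by (simp add: prod.remove)
  also have "cell_weight (insert v (T c0)) =
      xvar (nat \<bar>v\<bar>) * (if c0 \<in> D then xbeta else 1) * cell_weight (T c0)"
    using cell_weight_insert[OF factor_tableaux_finite_entry[OF tableau] last_entry_new[OF tableau]]
      factor_tableaux_filled[OF tableau] by (auto simp: filled_def)
  finally show ?thesis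
    using corner_cell(1) \<open>finite C\<close> by (simp add: prod.remove[of C c0] mult.assoc)
qed

lemma prod_cell_weight_remove_corner:
  assumes "T \<in> factor_tableaux ps (C - {c0})" "finite C"
  shows "(\<Prod>c\<in>C. cell_weight (T c)) = (\<Prod>c\<in>C - {c0}. cell_weight (T c))"
proof -
  have "T c0 = {}"
    using factor_tableaux_filled[OF assms(1)] by (auto simp: filled_def)
  then show ?thesis
    using corner_cell(1) assms(2) by (simp add: prod.remove)
qed

lemma sum_with_last_entry:
  "(\<Sum>T | T \<in> factor_tableaux (ps @ [(v, i)]) C \<and> v \<in> T c0. F T) =
    (\<Sum>T\<in>factor_tableaux ps C \<union> factor_tableaux ps (C - {c0}). F (T(c0 := insert v (T c0))))"
proof (rule sum.reindex_bij_witness[of _ "\<lambda>T. T(c0 := insert v (T c0))" "\<lambda>T. T(c0 := T c0 - {v})"])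
  fix T
  assume "T \<in> {T. T \<in> factor_tableaux (ps @ [(v, i)]) C \<and> v \<in> T c0}"
  then have tableau: "T \<in> factor_tableaux (ps @ [(v, i)]) C" and present: "v \<in> T c0" by simp_all
  show "T(c0 := T c0 - {v}) \<in> factor_tableaux ps C \<union> factor_tableaux ps (C - {c0})"
    using remove_last_entry[OF tableau] by (auto split: if_splits)
  show "(T(c0 := T c0 - {v}))(c0 := insert v ((T(c0 := T c0 - {v})) c0)) = T"
    using present by (auto simp: insert_absorb)
  then show "F ((T(c0 := T c0 - {v}))(c0 := insert v ((T(c0 := T c0 - {v})) c0))) = F T"
    by simp
next
  fix T
  assume tableau: "T \<in> factor_tableaux ps C \<union> factor_tableaux ps (C - {c0})"
  then have "v \<notin> T c0" using last_entry_new by blast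
  then show "(T(c0 := insert v (T c0)))(c0 := (T(c0 := insert v (T c0))) c0 - {v}) = T"
    by auto
  show "T(c0 := insert v (T c0)) \<in> {T. T \<in> factor_tableaux (ps @ [(v, i)]) C \<and> v \<in> T c0}"
    using tableau insert_last_entry[of T C] insert_last_entry[of T "C - {c0}"] corner_cell(1)
    by auto
qed

lemma tableau_sum_snoc_corner:
  assumes finite_cells: "finite C"
  shows "tableau_sum (ps @ [(v, i)]) C =
    tableau_sum ps C + xvar (nat \<bar>v\<bar>) * (xbeta * tableau_sum ps C + tableau_sum ps (C - {c0}))"
proof -
  let ?weight = "\<lambda>T. \<Prod>c\<in>C. cell_weight (T c)"
  let ?ins = "\<lambda>T. T(c0 := insert v (T c0))"
  have disjoint: "factor_tableaux ps C \<inter> factor_tableaux ps (C - {c0}) = {}"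
    using corner_cell(1) factor_tableaux_filled by blast
  have finite: "finite (factor_tableaux qs C)" "finite (factor_tableaux ps (C - {c0}))" for qs
    using finite_cells by (simp_all add: finite_factor_tableaux)
  have with_corner:
    "(\<Sum>T\<in>factor_tableaux ps C. ?weight (?ins T)) = xvar (nat \<bar>v\<bar>) * xbeta * tableau_sum ps C"
    unfolding tableau_sum_def sum_distrib_left
    using corner_cell(1)
    by (intro sum.cong refl)
      (simp add: prod_cell_weight_insert_last_entry[OF _ finite_cells] del: fun_upd_apply)
  have without_corner: "(\<Sum>T\<in>factor_tableaux ps (C - {c0}). ?weight (?ins T)) =
      xvar (nat \<bar>v\<bar>) * tableau_sum ps (C - {c0})"
    unfolding tableau_sum_def sum_distrib_left
    by (intro sum.cong refl)
      (simp add: prod_cell_weight_insert_last_entry[OF _ finite_cells]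
        prod_cell_weight_remove_corner[OF _ finite_cells] del: fun_upd_apply)
  have "tableau_sum (ps @ [(v, i)]) C =
      (\<Sum>T | T \<in> factor_tableaux (ps @ [(v, i)]) C \<and> v \<notin> T c0. ?weight T) +
      (\<Sum>T | T \<in> factor_tableaux (ps @ [(v, i)]) C \<and> v \<in> T c0. ?weight T)"
    unfolding tableau_sum_def using finite(1)
    by (subst sum.union_disjoint[symmetric]) (auto intro!: sum.cong)
  also have "\<dots> = tableau_sum ps C +
      (\<Sum>T\<in>factor_tableaux ps C \<union> factor_tableaux ps (C - {c0}). ?weight (?ins T))"
    unfolding factor_tableaux_without_last_entry sum_with_last_entry by (simp add: tableau_sum_def)
  also have "\<dots> = tableau_sum ps C +
      (xvar (nat \<bar>v\<bar>) * xbeta * tableau_sum ps C + xvar (nat \<bar>v\<bar>) * tableau_sum ps (C - {c0}))"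
    using finite disjoint
    by (simp add: sum.union_disjoint with_corner without_corner del: fun_upd_apply)
  finally show ?thesis by (simp add: distrib_left mult.assoc)
qed

end

section \<open>The product of the factors\<close>

definition factor :: "int \<times> nat \<Rightarrow> ualg" where
  "factor p = 1 + scal (xvar (nat \<bar>fst p\<bar>)) * ugen (snd p)"

lemma lin_ext_mult_factor:
  "lin_ext E (f * factor (v, i)) = lin_ext E f + xvar (nat \<bar>v\<bar>) * lin_ext (\<lambda>u. E (u + UWord [i])) f"
  by (simp add: factor_def distrib_left lin_ext_add ugen_def scal_mult_single lin_ext_mult_single)

lemma tableau_sum_cells_snoc:
  assumes inner: "staircase n g" and outer: "staircase n h"
    and last: "\<And>q. q \<in> set ps \<Longrightarrow> before q (v, i)"
  shows "tableau_sum (ps @ [(v, i)]) (cells g h) = tableau_sum ps (cells g h) +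
    (if removable g i h
     then xvar (nat \<bar>v\<bar>) *
       (xbeta * tableau_sum ps (cells g h) + tableau_sum ps (cells g (remove_box i h)))
     else 0)"
proof (cases "removable g i h")
  case True
  then have "corners i (cells g h) = {(h i, h i + i)}"
    by (simp add: corners_cells[OF inner outer])
  from tableau_sum_snoc_corner[OF last this finite_cells[OF outer]] show ?thesis
    unfolding cells_remove_box[OF True] by (simp add: True)
next
  case False
  then have "corners i (cells g h) = {}"
    by (simp add: corners_cells[OF inner outer])
  from tableau_sum_snoc_no_corner[OF last this] show ?thesis
    by (simp add: False)
qed

lemma lin_ext_shape_factor:
  "lin_ext (act_coeff (shape_step g) g h) (f * factor (v, i)) =
    lin_ext (act_coeff (shape_step g) g h) f +
    (if removable g i h
     then xvar (nat \<bar>v\<bar>) * (xbeta * lin_ext (act_coeff (shape_step g) g h) f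
       + lin_ext (act_coeff (shape_step g) g (remove_box i h)) f)
     else 0)"
  unfolding lin_ext_mult_factor act_coeff_shape_snoc by (simp add: lin_ext_linear_fun)

lemma (in inner_shape) lin_ext_shape_factors:
  "sorted_wrt before ps \<Longrightarrow> staircase n h \<Longrightarrow> g \<le> h \<Longrightarrow>
    lin_ext (act_coeff (shape_step g) g h) (prod_list (map factor ps)) = tableau_sum ps (cells g h)"
proof (induction ps arbitrary: h rule: rev_induct)
  case Nil
  have "lin_ext (act_coeff (shape_step g) g h) 1 = (if h = g then 1 else 0)"
    unfolding single_one[symmetric] lin_ext_single by (auto simp: act_coeff_def zero_uword_def)
  then show ?case
    using cells_eq_empty_iff[OF Nil(3)] by (simp add: tableau_sum_Nil)
next
  case (snoc p ps)
  obtain v i where p_eq: "p = (v, i)" by fastforce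
  have sorted: "sorted_wrt before ps" and last: "\<And>q. q \<in> set ps \<Longrightarrow> before q (v, i)"
    using snoc.prems(1) by (simp_all add: sorted_wrt_append p_eq)
  have smaller: "lin_ext (act_coeff (shape_step g) g (remove_box i h)) (prod_list (map factor ps)) =
      tableau_sum ps (cells g (remove_box i h))" if "removable g i h"
    using sorted staircase_remove_box[OF snoc.prems(2) that] le_remove_box[OF snoc.prems(3) that]
    by (rule snoc.IH)
  have "prod_list (map factor (ps @ [p])) = prod_list (map factor ps) * factor (v, i)"
    by (simp add: p_eq)
  then show ?case
    using tableau_sum_cells_snoc[OF staircase_inner snoc.prems(2) last]
    by (simp add: p_eq lin_ext_shape_factor snoc.IH[OF sorted snoc.prems(2,3)] smaller
        del: fun_upd_apply One_nat_def)
qed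

definition factor_list :: "nat \<Rightarrow> nat \<Rightarrow> (int \<times> nat) list" where
  "factor_list n m =
    concat (map (\<lambda>k. map (Pair (- int k)) (rev [0..<n]) @ map (Pair (int k)) [0..<n]) [1..<Suc m])"

lemma factor_list_0 [simp]: "factor_list n 0 = []"
  by (simp add: factor_list_def)

lemma factor_list_Suc:
  "factor_list n (Suc m) = factor_list n m @
    map (Pair (- int (Suc m))) (rev [0..<n]) @ map (Pair (int (Suc m))) [0..<n]"
  by (simp add: factor_list_def)

lemma set_factor_list: "set (factor_list n m) = {(v, i). v \<noteq> 0 \<and> \<bar>v\<bar> \<le> int m \<and> i < n}"
proof (induction m)
  case (Suc m)
  show ?case
    unfolding factor_list_Suc set_append Suc by (auto simp: image_iff)
qed auto

lemma C_prod_eq_factors: "C_prod n m = prod_list (map factor (factor_list n m))"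
proof (induction m)
  case 0
  then show ?case by (simp add: C_prod_def)
next
  case (Suc m)
  have "C_prod n (Suc m) = C_prod n m * C_factor n (Suc m)"
    by (simp add: C_prod_def)
  moreover have "C_factor n (Suc m) = prod_list (map factor
      (map (Pair (- int (Suc m))) (rev [0..<n]) @ map (Pair (int (Suc m))) [0..<n]))"
  proof -
    have "nat \<bar>- int (Suc m)\<bar> = Suc m" "nat \<bar>int (Suc m)\<bar> = Suc m" by simp_all
    then show ?thesis
      unfolding C_factor_def map_append map_map comp_def factor_def fst_conv snd_conv by simp
  qed
  ultimately show ?case
    unfolding factor_list_Suc using Suc by simp
qed

lemma C_prod_free_ualg: "C_prod n m \<in> free_ualg n"
proof -
  have "factor (v, i) \<in> free_ualg n" if "i < n" for v i
    unfolding factor_def ugen_def using that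
    by (intro free_ualg_add free_ualg_mult free_ualg_one free_ualg_scal free_ualg_single) simp
  then show ?thesis
    unfolding C_prod_eq_factors by (intro free_ualg_prod_list) (auto simp: set_factor_list)
qed

lemma sorted_factor_list: "sorted_wrt before (factor_list n m)"
proof (induction m)
  case (Suc m)
  let ?decreasing = "map (Pair (- int (Suc m))) (rev [0..<n])"
  let ?increasing = "map (Pair (int (Suc m))) [0..<n]"
  have "sorted_wrt before ?decreasing" "sorted_wrt before ?increasing"
    unfolding sorted_wrt_map sorted_wrt_rev
    by (rule sorted_wrt_mono_rel[OF _ sorted_wrt_upt]; simp add: before_def)+
  moreover have "before p q" if "p \<in> set ?decreasing" "q \<in> set ?increasing" for p q
    using that by (auto simp: before_def prec_def)
  moreover have "before p q" if "p \<in> set (factor_list n m)" "q \<in> set (?decreasing @ ?increasing)"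
    for p q
    using that by (auto simp: set_factor_list before_def prec_def)
  ultimately show ?case
    unfolding factor_list_Suc sorted_wrt_append using Suc by blast
qed simp

lemma (in inner_shape) u_coeffs_C_prod:
  assumes "growth_word g h b" "staircase n h"
  shows "u_coeffs n (C_prod n m) (word_perm b) = tableau_sum (factor_list n m) (cells g h)"
proof -
  have "u_coeffs n (C_prod n m) (word_perm b) = lin_ext (act_coeff (shape_step g) g h) (C_prod n m)"
    using assms C_prod_free_ualg by (rule u_coeffs_eq_lin_ext_shape)
  also have "\<dots> = tableau_sum (factor_list n m) (cells g h)"
    unfolding C_prod_eq_factors
    using sorted_factor_list assms(2) growth_word_le[OF assms(1)] by (rule lin_ext_shape_factors)
  finally show ?thesis .
qed

section \<open>Set-valued tableaux of skew shifted shapes\<close>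

definition prec_key :: "int \<Rightarrow> int" where
  "prec_key a = 2 * \<bar>a\<bar> + (if 0 < a then 1 else 0)"

lemma prec_iff_key: "prec a b \<longleftrightarrow> prec_key a < prec_key b"
  unfolding prec_def prec_key_def by (cases "0 < a"; cases "0 < b") (simp_all; linarith)+

lemma inj_prec_key: "inj prec_key"
proof (rule injI)
  fix a b
  assume "prec_key a = prec_key b"
  then show "a = b"
    unfolding prec_key_def by (cases "0 < a"; cases "0 < b") (simp_all; presburger)+
qed

lemma the_greatest_key:
  fixes f :: "'a \<Rightarrow> 'b::linorder"
  assumes "inj f" "finite A" "A \<noteq> {}"
  defines "m \<equiv> THE s. s \<in> A \<and> (\<forall>t\<in>A. t = s \<or> f t < f s)"
  shows "m \<in> A" "x \<in> A \<Longrightarrow> f x \<le> f m"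
proof -
  have "Max (f ` A) \<in> f ` A"
    using assms by (intro Max_in) auto
  then obtain a where attained: "a \<in> A" "f a = Max (f ` A)" by auto
  have greatest: "f t \<le> f a" if "t \<in> A" for t
    using attained(2) assms(2) that by simp
  have "m = a"
    unfolding m_def
  proof (rule the_equality)
    show "a \<in> A \<and> (\<forall>t\<in>A. t = a \<or> f t < f a)"
      using attained(1) greatest injD[OF assms(1)] by (auto simp: order_le_less)
  next
    fix s
    assume "s \<in> A \<and> (\<forall>t\<in>A. t = s \<or> f t < f s)"
    then show "s = a"
      using attained(1) greatest by (metis leD)
  qed
  with attained(1) greatest show "m \<in> A" "x \<in> A \<Longrightarrow> f x \<le> f m" by simp_all
qed

lemma prec_max_key:
  assumes "finite A" "A \<noteq> {}"
  shows "prec_max A \<in> A" "x \<in> A \<Longrightarrow> prec_key x \<le> prec_key (prec_max A)"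
  unfolding prec_max_def prec_iff_key using the_greatest_key[OF inj_prec_key assms] by simp_all

lemma prec_min_key:
  assumes "finite A" "A \<noteq> {}"
  shows "prec_min A \<in> A" "x \<in> A \<Longrightarrow> prec_key (prec_min A) \<le> prec_key x"
proof -
  have "inj (\<lambda>a. - prec_key a)"
    using inj_prec_key by (simp add: inj_def)
  from the_greatest_key[OF this assms]
  show "prec_min A \<in> A" "x \<in> A \<Longrightarrow> prec_key (prec_min A) \<le> prec_key x"
    unfolding prec_min_def prec_iff_key by simp_all
qed

lemma prec_max_min_iff:
  assumes "finite A" "A \<noteq> {}" "finite B" "B \<noteq> {}"
  shows "(let a = prec_max A; b = prec_min B in prec a b \<or> (a = b \<and> Q a)) \<longleftrightarrow>
    (\<forall>v\<in>A. \<forall>v'\<in>B. prec v v' \<or> (v = v' \<and> Q v))"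
  (is "?extremes \<longleftrightarrow> ?all")
proof
  assume extremes: ?extremes
  show ?all
  proof (intro ballI)
    fix v v'
    assume "v \<in> A" "v' \<in> B"
    then have between: "prec_key v \<le> prec_key (prec_max A)" "prec_key (prec_min B) \<le> prec_key v'"
      using prec_max_key(2)[OF assms(1,2)] prec_min_key(2)[OF assms(3,4)] by blast+
    show "prec v v' \<or> (v = v' \<and> Q v)"
    proof (cases "prec v v'")
      case False
      with between extremes have "prec_max A = prec_min B" "Q (prec_max A)"
        by (auto simp: Let_def prec_iff_key)
      moreover from this between False have "v = prec_max A" "v' = prec_max A"
        using injD[OF inj_prec_key] by (simp_all add: prec_iff_key)
      ultimately show ?thesis by simp
    qed simp
  qed
next
  assume ?all
  then show ?extremes
    using prec_max_key(1)[OF assms(1,2)] prec_min_key(1)[OF assms(3,4)] by (simp add: Let_def)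
qed

lemma before_below:
  assumes "i + 1 \<le> j"
  shows "before (v, diag_index (i, j)) (v', diag_index (i + 1, j)) \<longleftrightarrow> prec v v' \<or> (v = v' \<and> v < 0)"
  using assms by (auto simp: before_def diag_index_def)

lemma before_right:
  assumes "i \<le> j" "v \<noteq> 0"
  shows "before (v, diag_index (i, j)) (v', diag_index (i, j + 1)) \<longleftrightarrow> prec v v' \<or> (v = v' \<and> v > 0)"
  using assms by (auto simp: before_def diag_index_def)

lemma skew_diagram_le: "(i, j) \<in> skew_diagram \<nu> \<mu> \<Longrightarrow> i \<le> j"
  by (simp add: skew_diagram_def shifted_diagram_def)

lemma all_adjacent_iff:
  "(\<forall>c d. adjacent c d \<longrightarrow> P c d) \<longleftrightarrow> (\<forall>i j. P (i, j) (i + 1, j)) \<and> (\<forall>i j. P (i, j) (i, j + 1))"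
  unfolding adjacent_def by auto

lemma filled_skew_diagram_le:
  "filled T = skew_diagram \<nu> \<mu> \<Longrightarrow> v \<in> T (i, j) \<Longrightarrow> i \<le> j"
  by (rule skew_diagram_le[of _ _ \<nu> \<mu>]) (auto simp: filled_def)

lemma extremes_condition_iff:
  assumes "filled T = D" "\<And>c. finite (T c)"
  shows "(c \<in> D \<and> d \<in> D \<longrightarrow>
      (let a = prec_max (T c); b = prec_min (T d) in prec a b \<or> (a = b \<and> Q a))) \<longleftrightarrow>
    (\<forall>v\<in>T c. \<forall>v'\<in>T d. prec v v' \<or> (v = v' \<and> Q v))"
proof (cases "T c = {} \<or> T d = {}")
  case True
  with assms(1) show ?thesis by (auto simp: filled_def)
next
  case False
  with assms(1) have "c \<in> D" "d \<in> D" by (auto simp: filled_def)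
  with False show ?thesis
    using prec_max_min_iff[OF assms(2) _ assms(2), of c d Q] by simp
qed

lemma set_valued_tableaux_iff:
  "T \<in> set_valued_tableaux \<nu> \<mu> \<longleftrightarrow>
    filled T = skew_diagram \<nu> \<mu> \<and> (\<forall>c. finite (T c) \<and> 0 \<notin> T c) \<and>
    (\<forall>c d. adjacent c d \<longrightarrow> (\<forall>v\<in>T c. \<forall>v'\<in>T d. before (v, diag_index c) (v', diag_index d)))"
  (is "_ \<longleftrightarrow> filled T = ?D \<and> ?entries \<and> ?ordered")
proof -
  have "T \<in> set_valued_tableaux \<nu> \<mu> \<longleftrightarrow> filled T = ?D \<and> ?entries \<and>
      (\<forall>i j. (i, j) \<in> ?D \<and> (i + 1, j) \<in> ?D \<longrightarrow>
        (let a = prec_max (T (i, j)); b = prec_min (T (i + 1, j)) in prec a b \<or> (a = b \<and> a < 0))) \<and>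
      (\<forall>i j. (i, j) \<in> ?D \<and> (i, j + 1) \<in> ?D \<longrightarrow>
        (let a = prec_max (T (i, j)); b = prec_min (T (i, j + 1)) in prec a b \<or> (a = b \<and> a > 0)))"
    unfolding set_valued_tableaux_def filled_def by (auto; metis empty_iff finite.emptyI)
  also have "\<dots> \<longleftrightarrow> filled T = ?D \<and> ?entries \<and>
      (\<forall>i j. \<forall>v\<in>T (i, j). \<forall>v'\<in>T (i + 1, j). prec v v' \<or> (v = v' \<and> v < 0)) \<and>
      (\<forall>i j. \<forall>v\<in>T (i, j). \<forall>v'\<in>T (i, j + 1). prec v v' \<or> (v = v' \<and> v > 0))"
    by (intro conj_cong refl all_cong1 extremes_condition_iff) blast+
  also have "\<dots> \<longleftrightarrow> filled T = ?D \<and> ?entries \<and>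
      (\<forall>i j. \<forall>v\<in>T (i, j). \<forall>v'\<in>T (i + 1, j).
        before (v, diag_index (i, j)) (v', diag_index (i + 1, j))) \<and>
      (\<forall>i j. \<forall>v\<in>T (i, j). \<forall>v'\<in>T (i, j + 1).
        before (v, diag_index (i, j)) (v', diag_index (i, j + 1)))"
    by (intro conj_cong refl all_cong1 ball_cong before_below[symmetric] before_right[symmetric])
      (blast intro: filled_skew_diagram_le | metis)+
  also have "\<dots> \<longleftrightarrow> filled T = ?D \<and> ?entries \<and> ?ordered"
    unfolding all_adjacent_iff ..
  finally show ?thesis .
qed

lemma factor_tableaux_factor_list:
  assumes diag: "\<And>c. c \<in> skew_diagram \<nu> \<mu> \<Longrightarrow> diag_index c < n"
  shows "factor_tableaux (factor_list n m) (skew_diagram \<nu> \<mu>) =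
    {T \<in> set_valued_tableaux \<nu> \<mu>. \<forall>c. \<forall>s\<in>T c. \<bar>s\<bar> \<le> int m}"
proof (intro subset_antisym subsetI)
  fix T
  assume tableau: "T \<in> factor_tableaux (factor_list n m) (skew_diagram \<nu> \<mu>)"
  have "s \<noteq> 0 \<and> \<bar>s\<bar> \<le> int m" if "s \<in> T c" for s c
    using factor_tableaux_entry[OF tableau that] by (simp add: set_factor_list)
  moreover from this have "0 \<notin> T c" for c by blast
  ultimately show "T \<in> {T \<in> set_valued_tableaux \<nu> \<mu>. \<forall>c. \<forall>s\<in>T c. \<bar>s\<bar> \<le> int m}"
    using factor_tableaux_filled[OF tableau] factor_tableaux_before[OF tableau]
      factor_tableaux_finite_entry[OF tableau]
    unfolding mem_Collect_eq set_valued_tableaux_iff by blast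
next
  fix T
  assume "T \<in> {T \<in> set_valued_tableaux \<nu> \<mu>. \<forall>c. \<forall>s\<in>T c. \<bar>s\<bar> \<le> int m}"
  then have tableau: "filled T = skew_diagram \<nu> \<mu>" "0 \<notin> T c" "s \<in> T c \<Longrightarrow> \<bar>s\<bar> \<le> int m"
    and ordered: "adjacent c d \<Longrightarrow> s \<in> T c \<Longrightarrow> s' \<in> T d \<Longrightarrow> before (s, diag_index c) (s', diag_index d)"
    for c d s s'
    unfolding mem_Collect_eq set_valued_tableaux_iff by blast+
  show "T \<in> factor_tableaux (factor_list n m) (skew_diagram \<nu> \<mu>)"
  proof (rule factor_tableauxI[OF tableau(1) _ ordered])
    fix c s
    assume entry: "s \<in> T c"
    then have "diag_index c < n"
      using tableau(1) by (intro diag) (auto simp: filled_def)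
    moreover have "s \<noteq> 0"
      using entry tableau(2)[of c] by metis
    ultimately show "(s, diag_index c) \<in> set (factor_list n m)"
      using tableau(3)[OF entry] by (simp add: set_factor_list)
  qed
qed

lemma prod_single:
  fixes f :: "'c \<Rightarrow> 'a::comm_monoid_add" and g :: "'c \<Rightarrow> 'b::comm_semiring_1"
  shows "(\<Prod>x\<in>A. Poly_Mapping.single (f x) (g x)) = Poly_Mapping.single (\<Sum>x\<in>A. f x) (\<Prod>x\<in>A. g x)"
  by (induction A rule: infinite_finite_induct) (simp_all add: mult_single)

lemma cell_weight_eq_single:
  "cell_weight A =
    Poly_Mapping.single (\<Sum>s\<in>A. Poly_Mapping.single (nat \<bar>s\<bar>) 1) (beta ^ (card A - 1))"
  by (simp add: cell_weight_def xvar_def prod_single xbeta_power mult_single)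

lemma prod_cell_weight_eq_single:
  assumes tableau: "T \<in> set_valued_tableaux \<nu> \<mu>"
  shows "(\<Prod>c\<in>skew_diagram \<nu> \<mu>. cell_weight (T c)) =
    Poly_Mapping.single (tableau_weight \<nu> \<mu> T)
      (beta ^ (tableau_size \<nu> \<mu> T - card (skew_diagram \<nu> \<mu>)))"
proof -
  have "1 \<le> card (T c)" if "c \<in> skew_diagram \<nu> \<mu>" for c
    using that tableau by (auto simp: set_valued_tableaux_def Suc_le_eq card_gt_0_iff)
  then have "(\<Sum>c\<in>skew_diagram \<nu> \<mu>. card (T c) - 1) = tableau_size \<nu> \<mu> T - card (skew_diagram \<nu> \<mu>)"
    unfolding tableau_size_def by (subst sum_subtractf_nat) simp_all
  then show ?thesis
    by (simp add: cell_weight_eq_single prod_single tableau_weight_def flip: power_sum)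
qed

lemma tableau_weight_keys:
  assumes finite_cells: "finite (skew_diagram \<nu> \<mu>)" and tableau: "T \<in> set_valued_tableaux \<nu> \<mu>"
    and entry: "s \<in> T c"
  shows "nat \<bar>s\<bar> \<in> Poly_Mapping.keys (tableau_weight \<nu> \<mu> T)"
proof -
  let ?D = "skew_diagram \<nu> \<mu>"
  let ?count = "\<lambda>t :: int. Poly_Mapping.lookup (Poly_Mapping.single (nat \<bar>t\<bar>) (1 :: nat)) (nat \<bar>s\<bar>)"
  have cell: "c \<in> ?D" "finite (T c)"
    using tableau entry unfolding set_valued_tableaux_iff filled_def by blast+
  have "?count s \<le> (\<Sum>t\<in>T c. ?count t)"
    using entry cell(2) by (intro member_le_sum) simp_all
  also have "\<dots> \<le> (\<Sum>d\<in>?D. \<Sum>t\<in>T d. ?count t)"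
    using cell(1) finite_cells by (intro member_le_sum) simp_all
  also have "\<dots> = Poly_Mapping.lookup (tableau_weight \<nu> \<mu> T) (nat \<bar>s\<bar>)"
    by (simp add: tableau_weight_def lookup_sum)
  finally show ?thesis by (simp add: in_keys_iff)
qed

lemma lookup_tableau_sum:
  assumes finite_cells: "finite (skew_diagram \<nu> \<mu>)"
    and diag: "\<And>c. c \<in> skew_diagram \<nu> \<mu> \<Longrightarrow> diag_index c < n"
    and large: "\<And>k. k \<in> Poly_Mapping.keys \<alpha> \<Longrightarrow> k \<le> m"
  shows "Poly_Mapping.lookup (tableau_sum (factor_list n m) (skew_diagram \<nu> \<mu>)) \<alpha> = GQ \<nu> \<mu> \<alpha>"
proof -
  let ?D = "skew_diagram \<nu> \<mu>"
  let ?P = "factor_tableaux (factor_list n m) ?D"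
  let ?coeff = "\<lambda>T. beta ^ (tableau_size \<nu> \<mu> T - card ?D)"
  have tableaux_eq: "?P = {T \<in> set_valued_tableaux \<nu> \<mu>. \<forall>c. \<forall>s\<in>T c. \<bar>s\<bar> \<le> int m}"
    using diag by (rule factor_tableaux_factor_list)
  have "\<bar>s\<bar> \<le> int m"
    if "T \<in> set_valued_tableaux \<nu> \<mu>" "tableau_weight \<nu> \<mu> T = \<alpha>" "s \<in> T c" for T s c
    using large[of "nat \<bar>s\<bar>"] tableau_weight_keys[OF finite_cells that(1,3)] that(2) by simp
  then have weight_\<alpha>: "{T \<in> ?P. tableau_weight \<nu> \<mu> T = \<alpha>} =
      {T \<in> set_valued_tableaux \<nu> \<mu>. tableau_weight \<nu> \<mu> T = \<alpha>}"
    unfolding tableaux_eq by blast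
  have "tableau_sum (factor_list n m) ?D =
      (\<Sum>T\<in>?P. Poly_Mapping.single (tableau_weight \<nu> \<mu> T) (?coeff T))"
    unfolding tableau_sum_def
    by (intro sum.cong refl prod_cell_weight_eq_single) (simp add: tableaux_eq)
  then have "Poly_Mapping.lookup (tableau_sum (factor_list n m) ?D) \<alpha> =
      (\<Sum>T\<in>?P. if tableau_weight \<nu> \<mu> T = \<alpha> then ?coeff T else 0)"
    by (simp add: lookup_sum lookup_single when_def)
  also have "\<dots> = (\<Sum>T | T \<in> ?P \<and> tableau_weight \<nu> \<mu> T = \<alpha>. ?coeff T)"
    using finite_factor_tableaux[OF finite_cells] by (simp add: sum.inter_filter)
  also have "\<dots> = GQ \<nu> \<mu> \<alpha>"
    unfolding weight_\<alpha> GQ_def by simp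
  finally show ?thesis .
qed

definition diag_count :: "nat list \<Rightarrow> nat \<Rightarrow> nat" where
  "diag_count l i = card {x \<in> set l. i < x}"

lemma staircase_diag_count:
  assumes "\<forall>x\<in>set l. x \<le> n"
  shows "staircase n (diag_count l)"
proof -
  have "diag_count l (Suc i) \<le> diag_count l i" for i
    unfolding diag_count_def by (intro card_mono) auto
  moreover have "diag_count l i \<le> Suc (diag_count l (Suc i))" for i
  proof -
    have "diag_count l i \<le> card (insert (Suc i) {x \<in> set l. Suc i < x})"
      unfolding diag_count_def by (intro card_mono) auto
    also have "\<dots> \<le> Suc (diag_count l (Suc i))"
      unfolding diag_count_def by (simp add: card_insert_if)
    finally show ?thesis .
  qed
  moreover have "diag_count l i = 0" if "n \<le> i" for i
    using assms that by (force simp: diag_count_def)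
  ultimately show ?thesis by (simp add: staircase_def)
qed

lemma less_diag_count_iff:
  "sorted_wrt (>) l \<Longrightarrow> j < diag_count l i \<longleftrightarrow> j < length l \<and> i < l ! j"
proof (induction l arbitrary: j)
  case (Cons x l)
  have smaller: "y < x" if "y \<in> set l" for y
    using Cons.prems that by simp
  show ?case
  proof (cases "i < x")
    case True
    then have "{y \<in> set (x # l). i < y} = insert x {y \<in> set l. i < y}" by auto
    then have "diag_count (x # l) i = Suc (diag_count l i)"
      using smaller by (auto simp: diag_count_def card_insert_if)
    with True Cons show ?thesis by (cases j) simp_all
  next
    case False
    then have none: "\<not> i < y" if "y \<in> set (x # l)" for y
      using smaller that by force
    then have "diag_count (x # l) i = 0" by (auto simp: diag_count_def)
    moreover have "\<not> i < (x # l) ! j" if "j < length (x # l)"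
      using none nth_mem[OF that] by blast
    ultimately show ?thesis by auto
  qed
qed (simp add: diag_count_def)

lemma shifted_diagram_iff:
  assumes "strict_partition l"
  shows "(r, c) \<in> shifted_diagram l \<longleftrightarrow> 1 \<le> r \<and> r \<le> c \<and> r \<le> diag_count l (c - r)"
proof (cases "1 \<le> r \<and> r \<le> c")
  case True
  then have "r \<le> diag_count l (c - r) \<longleftrightarrow> r \<le> length l \<and> c - r < l ! (r - 1)"
    using less_diag_count_iff[of l "r - 1" "c - r"] assms by (auto simp: strict_partition_def)
  moreover have "c \<le> l ! (r - 1) + r - 1 \<longleftrightarrow> c - r < l ! (r - 1)"
    using True by auto
  ultimately show ?thesis using True by (simp add: shifted_diagram_def)
qed (auto simp: shifted_diagram_def)

lemma skew_diagram_eq_cells: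
  assumes "strict_partition \<mu>" "strict_partition \<nu>"
  shows "skew_diagram \<nu> \<mu> = cells (diag_count \<mu>) (diag_count \<nu>)"
  by (auto simp: skew_diagram_def cells_def shifted_diagram_iff[OF assms(1)]
      shifted_diagram_iff[OF assms(2)])

lemma diag_count_mono:
  assumes "strict_partition \<mu>" "strict_partition \<nu>" "shifted_diagram \<mu> \<subseteq> shifted_diagram \<nu>"
  shows "diag_count \<mu> \<le> diag_count \<nu>"
proof (rule le_funI)
  fix i
  let ?r = "diag_count \<mu> i"
  show "?r \<le> diag_count \<nu> i"
  proof (cases "?r = 0")
    case False
    then have "(?r, ?r + i) \<in> shifted_diagram \<mu>"
      by (simp add: shifted_diagram_iff[OF assms(1)])
    with assms(3) have "(?r, ?r + i) \<in> shifted_diagram \<nu>" by blast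
    then show ?thesis by (simp add: shifted_diagram_iff[OF assms(2)])
  qed simp
qed

lemma GC_growth_word_eq_GQ:
  assumes partitions: "strict_partition \<mu>" "strict_partition \<nu>"
    and inner: "staircase n (diag_count \<mu>)" and outer: "staircase n (diag_count \<nu>)"
    and growth: "growth_word (diag_count \<mu>) (diag_count \<nu>) b"
  shows "GC n (word_perm b) = GQ \<nu> \<mu>"
proof
  fix \<alpha>
  interpret inner_shape n "diag_count \<mu>"
    by standard (rule inner)
  note cells_eq = skew_diagram_eq_cells[OF partitions]
  have "Poly_Mapping.lookup (u_coeffs n (C_prod n m) (word_perm b)) \<alpha> = GQ \<nu> \<mu> \<alpha>"
    if "Max (insert 0 (Poly_Mapping.keys \<alpha>)) \<le> m" for m
    unfolding u_coeffs_C_prod[OF growth outer] cells_eq[symmetric]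
  proof (rule lookup_tableau_sum)
    show "finite (skew_diagram \<nu> \<mu>)"
      unfolding cells_eq using outer by (rule finite_cells)
    show "diag_index c < n" if "c \<in> skew_diagram \<nu> \<mu>" for c
      using outer that unfolding cells_eq by (rule cells_diag_index_less)
    show "k \<le> m" if "k \<in> Poly_Mapping.keys \<alpha>" for k
      using that \<open>Max (insert 0 (Poly_Mapping.keys \<alpha>)) \<le> m\<close> by simp
  qed
  then show "GC n (word_perm b) \<alpha> = GQ \<nu> \<mu> \<alpha>"
    by (intro GC_eqI eventually_sequentiallyI)
qed

theorem theorem1p5:
  fixes \<mu> \<nu> :: "nat list"
  assumes "strict_partition \<mu>" and "strict_partition \<nu>"
    and "shifted_diagram \<mu> \<subseteq> shifted_diagram \<nu>"
  shows "\<exists>n w. n \<ge> 1 \<and> w \<in> signed_perms n \<and> GC n w = GQ \<nu> \<mu>"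
proof -
  define n where "n = Suc (sum_list \<mu> + sum_list \<nu>)"
  have inner: "staircase n (diag_count \<mu>)" and outer: "staircase n (diag_count \<nu>)"
    by (auto simp: n_def intro!: staircase_diag_count dest!: member_le_sum_list)
  obtain b where growth: "growth_word (diag_count \<mu>) (diag_count \<nu>) b"
    using exists_growth_word[OF inner outer diag_count_mono[OF assms]] by blast
  have "word_perm b \<in> signed_perms n"
    using growth_word_letters[OF growth outer] by (rule word_perm_signed_perms)
  moreover have "GC n (word_perm b) = GQ \<nu> \<mu>"
    using assms(1,2) inner outer growth by (rule GC_growth_word_eq_GQ)
  moreover have "n \<ge> 1"
    by (simp add: n_def)
  ultimately show ?thesis by blast
qed

end
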